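(* Let $A$ be a nonfree abelian group and $\kappa=|A|$, and let $0\to K\to F\to A\to 0$ be a short exact sequence with $F,K$ free and $K\subseteq F$. Let $S_\kappa$ be the Stone space of the Boolean completion $\mathbb{B}_\kappa$ of $\mathrm{Add}(\omega,\kappa)$. Then there is a continuous map $\varphi:S_\kappa\to\mathrm{Hom}(K,\mathbb{Z})$ which cannot be lifted pointwise to a continuous map $\psi:S_\kappa\to\mathrm{Hom}(F,\mathbb{Z})$ (i.e. with $\psi(U)\restriction K=\varphi(U)$ for all $U\in S_\kappa$). Moreover, given a basis $B_K$ of $K$, $\varphi$ can be chosen with $\varphi(U)(t)\in\{0,1\}$ for all $U\in S_\kappa$ and $t\in B_K$.
   Context: $\mathrm{Add}(\omega,\kappa)$ is the poset of finite partial functions from $\kappa$ to $\{0,1\}$ ordered by reverse inclusion. The Stone space of a Boolean algebra $\mathbb{B}$ is the space of its ultrafilters with basic clopen sets $N_b=\{U: b\in U\}$, $b\in\mathbb{B}$. $\mathrm{Hom}(G,\mathbb{Z})$ for discrete $G$ carries the topology inherited from the product space $\mathbb{Z}^G$. *)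

theory Defs
  imports "HOL-Analysis.Analysis" "HOL-Algebra.Free_Abelian_Groups"
begin

text \<open>Groups are written multiplicatively, so the \<open>\<int>\<close>-linear combination of elements \<open>b \<in> B\<close> with
  integer coefficients \<open>c b\<close>, almost all zero, is the product of the powers of \<open>b\<close> with exponents \<open>c b\<close>.\<close>

definition int_combination :: "('a, 'm) monoid_scheme \<Rightarrow> ('a \<Rightarrow>\<^sub>0 int) \<Rightarrow> 'a" where
  "int_combination G c = finprod G (\<lambda>b. b [^]\<^bsub>G\<^esub> Poly_Mapping.lookup c b) (Poly_Mapping.keys c)"

definition is_basis :: "('a, 'm) monoid_scheme \<Rightarrow> 'a set \<Rightarrow> bool" where
  "is_basis G B \<longleftrightarrow> B \<subseteq> carrier G \<and>
     (\<forall>x \<in> carrier G. \<exists>!c. c \<in> carrier (free_Abelian_group B) \<and> int_combination G c = x)"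

definition is_free_abelian :: "('a, 'm) monoid_scheme \<Rightarrow> bool" where
  "is_free_abelian G \<longleftrightarrow> comm_group G \<and> (\<exists>B. is_basis G B)"

text \<open>The points of \<^const>\<open>product_topology\<close> are extensional functions, so a homomorphism is
  represented by exactly one point, which is \<^const>\<open>undefined\<close> outside the carrier.\<close>

definition Hom_int :: "('a, 'm) monoid_scheme \<Rightarrow> ('a \<Rightarrow> int) topology" where
  "Hom_int G = subtopology (product_topology (\<lambda>_. discrete_topology UNIV) (carrier G))
                 (hom G integer_group)"

text \<open>A cardinal is a well-order \<open>\<kappa>\<close> with \<^prop>\<open>Card_order \<kappa>\<close>; as a set it is \<^term>\<open>Field \<kappa>\<close>.
  The values \<open>0\<close> and \<open>1\<close> are \<^const>\<open>False\<close> and \<^const>\<open>True\<close>.\<close>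

definition Add_omega :: "'k rel \<Rightarrow> ('k \<rightharpoonup> bool) gorder" where
  "Add_omega \<kappa> = \<lparr>carrier = {p. finite (dom p) \<and> dom p \<subseteq> Field \<kappa>}, eq = (=), le = (\<lambda>p q. q \<subseteq>\<^sub>m p)\<rparr>"

text \<open>The open sets of the topology of a poset are the downward closed sets, and the Boolean
  completion of the poset is its algebra of regular open sets.\<close>

definition poset_topology :: "('p, 'm) gorder_scheme \<Rightarrow> 'p topology" where
  "poset_topology P = topology_generated_by {{q \<in> carrier P. q \<sqsubseteq>\<^bsub>P\<^esub> p} | p. p \<in> carrier P}"

definition boolean_completion :: "('p, 'm) gorder_scheme \<Rightarrow> 'p set gorder" where
  "boolean_completion P =
     \<lparr>carrier = {b. poset_topology P interior_of (Abstract_Topology.closure_of (poset_topology P) b) = b},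
      eq = (=), le = (\<subseteq>)\<rparr>"

definition proper_filter :: "('b, 'm) gorder_scheme \<Rightarrow> 'b set \<Rightarrow> bool" where
  "proper_filter L U \<longleftrightarrow> U \<subseteq> carrier L \<and> \<top>\<^bsub>L\<^esub> \<in> U \<and> \<bottom>\<^bsub>L\<^esub> \<notin> U \<and>
     (\<forall>a \<in> U. \<forall>b \<in> U. a \<sqinter>\<^bsub>L\<^esub> b \<in> U) \<and>
     (\<forall>a \<in> U. \<forall>b \<in> carrier L. a \<sqsubseteq>\<^bsub>L\<^esub> b \<longrightarrow> b \<in> U)"

definition ultrafilter :: "('b, 'm) gorder_scheme \<Rightarrow> 'b set \<Rightarrow> bool" where
  "ultrafilter L U \<longleftrightarrow> proper_filter L U \<and> (\<forall>V. proper_filter L V \<and> U \<subseteq> V \<longrightarrow> V = U)"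

definition Stone_space :: "('b, 'm) gorder_scheme \<Rightarrow> 'b set topology" where
  "Stone_space L = topology_generated_by {{U. ultrafilter L U \<and> b \<in> U} | b. b \<in> carrier L}"

end

(* A continuous map S -> Hom(F, Z) is the same thing as a homomorphism F -> C(S, Z). Suppose first that
   K has a basis of at most kappa elements, and let phi correspond to the homomorphism K -> C(S, Z) that
   sends distinct basis elements to the indicators of distinct Cohen coordinates. By Noebeling's
   argument these indicators are part of a basis of C(S, Z), so they have a dual family
   of functionals, only finitely many of which are nonzero at any given function. A lift
   F -> C(S, Z) of phi therefore yields a retraction of F onto K, so A is isomorphic to a subgroup
   of F and hence free.
   In general K may be larger than A. If A is infinite, only the at most kappa basis elements of K in
   the relations s(a) + s(b) - s(a + b) between representatives of the elements of A matter. If A is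
   finite, these are finitely many, and one of their coordinate functions K -> Z already has no
   extension to F, so phi can be taken constant. *)

theory Submission
  imports Defs
begin

section \<open>Noebeling's theorem relative to an ideal of sets\<close>

text \<open>Each function needs dual functionals that vanish at it almost everywhere. Without this
  finiteness the coordinates would land in a product rather than a direct sum and define no
  retraction. Independence of the Cohen coordinates does not give this directly, but Noebeling's
  basis may be built along any well-order of the coordinates. With the Cohen coordinates placed
  first, independence makes each of them a basis monomial, and its dual functional is a coefficient
  of the expansion, which is finite. An ultrafilter is a set of regular open sets, hence a point of
  the cube of all subsets. Continuous integer functions on the Stone space are restrictions of
  functions f on that cube with \<open>depends_on f UNIV\<close>. Noebeling's recursion passes from
  a closed set to intersections of projections of its parts. Coding a closed set by the ideal of
  sets disjoint from it keeps every stage in the same cube and reduces all arguments to finitely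
  many coordinates.\<close>

definition depends_on :: "('i set \<Rightarrow> 'v) \<Rightarrow> 'i set \<Rightarrow> bool" where
  "depends_on f D \<longleftrightarrow> (\<exists>G. finite G \<and> G \<subseteq> D \<and> (\<forall>x. f x = f (x \<inter> G)))"

lemma depends_onI: "finite G \<Longrightarrow> G \<subseteq> D \<Longrightarrow> (\<And>x. f x = f (x \<inter> G)) \<Longrightarrow> depends_on f D"
  unfolding depends_on_def by blast

lemma depends_on_const [simp]: "depends_on (\<lambda>_. c) D"
  unfolding depends_on_def by auto

lemma depends_on_combine:
  assumes "depends_on f D" "depends_on g D"
  shows "depends_on (\<lambda>x. h (f x) (g x)) D"
proof -
  obtain G where G: "finite G" "G \<subseteq> D" "\<And>x. f x = f (x \<inter> G)"
    using assms(1) unfolding depends_on_def by blast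
  obtain H where H: "finite H" "H \<subseteq> D" "\<And>x. g x = g (x \<inter> H)"
    using assms(2) unfolding depends_on_def by blast
  have 1: "f x = f (x \<inter> (G \<union> H))" for x
    by (metis G(3) Int_absorb2 Int_assoc Un_upper1 inf_commute)
  have 2: "g x = g (x \<inter> (G \<union> H))" for x
    by (metis H(3) Int_absorb2 Int_assoc Un_upper2 inf_commute)
  show ?thesis
    by (rule depends_onI [of "G \<union> H"]) (use G H 1 2 in auto)
qed

lemma depends_on_map: "depends_on f D \<Longrightarrow> depends_on (\<lambda>x. h (f x)) D"
  using depends_on_combine [of f D f "\<lambda>a _. h a"] by simp

lemma depends_on_subset: "finite F \<Longrightarrow> F \<subseteq> D \<Longrightarrow> depends_on (\<lambda>x. F \<subseteq> x) D"
  by (rule depends_onI [of F]) auto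

lemma depends_on_sum:
  assumes "finite A" "\<And>a. a \<in> A \<Longrightarrow> depends_on (f a) D"
  shows "depends_on (\<lambda>x. \<Sum>a\<in>A. f a x :: int) D"
  using assms
proof (induction A rule: finite_induct)
  case (insert a A)
  then have "depends_on (\<lambda>x. f a x + (\<Sum>a\<in>A. f a x)) D"
    using depends_on_combine [where h = "(+)"] by blast
  with insert show ?case by simp
qed simp

text \<open>An ideal may contain \<open>UNIV\<close>: this codes the empty closed set, which the
  recursion reaches and for which no monomial is standard.\<close>

definition set_ideal :: "'x set set \<Rightarrow> bool" where
  "set_ideal \<I> \<longleftrightarrow> {} \<in> \<I> \<and> (\<forall>a\<in>\<I>. \<forall>b\<in>\<I>. a \<union> b \<in> \<I>) \<and> (\<forall>a\<in>\<I>. \<forall>b. b \<subseteq> a \<longrightarrow> b \<in> \<I>)"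

lemma set_ideal_sub: "set_ideal \<I> \<Longrightarrow> a \<in> \<I> \<Longrightarrow> b \<subseteq> a \<Longrightarrow> b \<in> \<I>"
  unfolding set_ideal_def by blast

lemma set_ideal_sub2: "set_ideal \<I> \<Longrightarrow> a \<in> \<I> \<Longrightarrow> b \<in> \<I> \<Longrightarrow> c \<subseteq> a \<union> b \<Longrightarrow> c \<in> \<I>"
  unfolding set_ideal_def by blast

lemma set_ideal_empty: "set_ideal \<I> \<Longrightarrow> {} \<in> \<I>"
  unfolding set_ideal_def by blast

text \<open>A finite set \<open>F\<close> of coordinates encodes the product of these coordinates, which is the
  indicator function of \<open>{x. F \<subseteq> x}\<close>.\<close>

definition lin :: "('i set \<Rightarrow> int) \<Rightarrow> 'i set \<Rightarrow> int" where
  "lin c x = (\<Sum>F | c F \<noteq> 0. c F * of_bool (F \<subseteq> x))"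

lemma lin_superset: "finite A \<Longrightarrow> {F. c F \<noteq> 0} \<subseteq> A \<Longrightarrow> lin c x = (\<Sum>F\<in>A. c F * of_bool (F \<subseteq> x))"
  unfolding lin_def by (rule sum.mono_neutral_left) auto

lemma lin_diff:
  assumes "finite {F. c F \<noteq> 0}" "finite {F. d F \<noteq> 0}"
  shows "lin (\<lambda>F. c F - d F) x = lin c x - lin d x"
proof -
  let ?A = "{F. c F \<noteq> 0} \<union> {F. d F \<noteq> 0}"
  have fin: "finite ?A" using assms by simp
  have "{F. c F - d F \<noteq> 0} \<subseteq> ?A" by fastforce
  then have "lin (\<lambda>F. c F - d F) x = (\<Sum>F\<in>?A. (c F - d F) * of_bool (F \<subseteq> x))"
    by (rule lin_superset [OF fin])
  moreover have "lin c x = (\<Sum>F\<in>?A. c F * of_bool (F \<subseteq> x))"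
    by (rule lin_superset [OF fin]) blast
  moreover have "lin d x = (\<Sum>F\<in>?A. d F * of_bool (F \<subseteq> x))"
    by (rule lin_superset [OF fin]) blast
  ultimately show ?thesis
    by (simp only: left_diff_distrib sum_subtractf)
qed

text \<open>Coordinates are idempotent, so every combination of monomials is linear in each of them:
  it is a + x_\<nu> b with a and b free of \<nu>. Existence and uniqueness of normal forms both
  recurse along this splitting.\<close>

lemma lin_split:
  assumes fin: "finite {F. c F \<noteq> 0}"
  shows "lin c x = lin (\<lambda>F. if \<nu> \<in> F then 0 else c F) x
     + of_bool (\<nu> \<in> x) * lin (\<lambda>F. if \<nu> \<in> F then 0 else c (insert \<nu> F)) x"
proof -
  let ?S = "{F. c F \<noteq> 0}"
  let ?d = "\<lambda>F. if \<nu> \<in> F then 0 else c F" and ?e = "\<lambda>F. if \<nu> \<in> F then 0 else c (insert \<nu> F)"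
  have S: "?S = {F \<in> ?S. \<nu> \<notin> F} \<union> {F \<in> ?S. \<nu> \<in> F}" by auto
  have e: "{F. ?e F \<noteq> 0} = (\<lambda>F. F - {\<nu>}) ` {F \<in> ?S. \<nu> \<in> F}"
  proof (intro subset_antisym subsetI)
    fix F assume "F \<in> {F. ?e F \<noteq> 0}"
    then have "\<nu> \<notin> F" "c (insert \<nu> F) \<noteq> 0" by (auto split: if_splits)
    then show "F \<in> (\<lambda>F. F - {\<nu>}) ` {F \<in> ?S. \<nu> \<in> F}"
      by (intro image_eqI [of _ _ "insert \<nu> F"]) auto
  qed (auto simp: insert_absorb)
  have inj: "inj_on (\<lambda>F. F - {\<nu>}) {F \<in> ?S. \<nu> \<in> F}"
    by (rule inj_onI) auto
  have "lin c x = (\<Sum>F | c F \<noteq> 0 \<and> \<nu> \<notin> F. c F * of_bool (F \<subseteq> x))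
      + (\<Sum>F | c F \<noteq> 0 \<and> \<nu> \<in> F. c F * of_bool (F \<subseteq> x))"
    unfolding lin_def by (subst S, subst sum.union_disjoint) (use fin in auto)
  also have "(\<Sum>F | c F \<noteq> 0 \<and> \<nu> \<notin> F. c F * of_bool (F \<subseteq> x)) = lin ?d x"
    unfolding lin_def by (rule sum.cong) auto
  also have "(\<Sum>F | c F \<noteq> 0 \<and> \<nu> \<in> F. c F * of_bool (F \<subseteq> x)) = of_bool (\<nu> \<in> x) * lin ?e x"
    unfolding lin_def sum_distrib_left e sum.reindex [OF inj] o_def
    by (rule sum.cong) (auto simp: insert_absorb)
  finally show ?thesis .
qed

lemma depends_on_lin:
  assumes "finite {F. c F \<noteq> 0}" "\<And>F. c F \<noteq> 0 \<Longrightarrow> finite F \<and> F \<subseteq> D"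
  shows "depends_on (lin c) D"
proof -
  have "depends_on (\<lambda>x. \<Sum>F | c F \<noteq> 0. c F * of_bool (F \<subseteq> x)) D"
    by (intro depends_on_sum assms depends_on_map [OF depends_on_subset, where h = "\<lambda>a. _ * of_bool a"])
      (use assms in auto)
  then show ?thesis by (simp add: lin_def [abs_def])
qed

section \<open>Well-ordered coordinates, the derived ideal and standard monomials\<close>

locale strict_wellorder =
  fixes less :: "'i \<Rightarrow> 'i \<Rightarrow> bool" (infix "\<lless>" 50)
  assumes wfp: "wfp (\<lless>)"
    and trans: "x \<lless> y \<Longrightarrow> y \<lless> z \<Longrightarrow> x \<lless> z"
    and total: "x \<lless> y \<or> x = y \<or> y \<lless> x"
begin

lemma irrefl: "\<not> x \<lless> x"
  using wfp by (simp add: wfp_imp_irreflp irreflpD)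

lemma finite_has_max:
  assumes "finite G" "G \<noteq> {}"
  obtains \<nu> where "\<nu> \<in> G" "\<And>x. x \<in> G \<Longrightarrow> x = \<nu> \<or> x \<lless> \<nu>"
proof -
  have "\<exists>\<nu>\<in>G. \<forall>x\<in>G. x = \<nu> \<or> x \<lless> \<nu>"
    using assms
  proof (induction G rule: finite_ne_induct)
    case (insert a G)
    then obtain \<nu> where "\<nu> \<in> G" "\<forall>x\<in>G. x = \<nu> \<or> x \<lless> \<nu>" by blast
    with total [of a \<nu>] trans show ?case by (metis insert_iff)
  qed simp
  then show ?thesis using that by blast
qed

definition below :: "'i \<Rightarrow> 'i set" where
  "below \<nu> = {x. x \<lless> \<nu>}"

text \<open>For \<open>\<I>\<close> the ideal of sets disjoint from a closed set \<open>S\<close>, this is the ideal of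
  sets disjoint from \<open>S\<^sub>0 \<inter> S\<^sub>1\<close>, where \<open>S\<^sub>0, S\<^sub>1\<close> are the projections to the coordinates below \<open>\<nu>\<close>
  of the two parts of \<open>S\<close> on which the coordinate \<open>\<nu>\<close> is constant.\<close>

definition deriv_ideal :: "'i \<Rightarrow> 'i set set set \<Rightarrow> 'i set set set" where
  "deriv_ideal \<nu> \<I> = {Z. \<exists>b0 b1. depends_on (\<lambda>x. x \<in> b0) (below \<nu>) \<and> depends_on (\<lambda>x. x \<in> b1) (below \<nu>)
     \<and> Z \<subseteq> b0 \<union> b1 \<and> b0 \<inter> {x. \<nu> \<notin> x} \<in> \<I> \<and> b1 \<inter> {x. \<nu> \<in> x} \<in> \<I>}"

lemma set_ideal_deriv:
  assumes "set_ideal \<I>"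
  shows "set_ideal (deriv_ideal \<nu> \<I>)"
  unfolding set_ideal_def
proof (intro conjI ballI allI impI)
  show "{} \<in> deriv_ideal \<nu> \<I>"
    unfolding deriv_ideal_def using set_ideal_empty [OF assms]
    by (auto intro!: exI [of _ "{}"])
next
  fix a b assume "a \<in> deriv_ideal \<nu> \<I>" "b \<in> deriv_ideal \<nu> \<I>"
  then obtain a0 a1 b0 b1 where
    ab: "depends_on (\<lambda>x. x \<in> a0) (below \<nu>)" "depends_on (\<lambda>x. x \<in> a1) (below \<nu>)"
     "a \<subseteq> a0 \<union> a1" "a0 \<inter> {x. \<nu> \<notin> x} \<in> \<I>" "a1 \<inter> {x. \<nu> \<in> x} \<in> \<I>"
     "depends_on (\<lambda>x. x \<in> b0) (below \<nu>)" "depends_on (\<lambda>x. x \<in> b1) (below \<nu>)"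
     "b \<subseteq> b0 \<union> b1" "b0 \<inter> {x. \<nu> \<notin> x} \<in> \<I>" "b1 \<inter> {x. \<nu> \<in> x} \<in> \<I>"
    unfolding deriv_ideal_def by blast
  have "depends_on (\<lambda>x. x \<in> a0 \<union> b0) (below \<nu>)" "depends_on (\<lambda>x. x \<in> a1 \<union> b1) (below \<nu>)"
    using depends_on_combine [OF ab(1) ab(6), of "(\<or>)"] depends_on_combine [OF ab(2) ab(7), of "(\<or>)"]
    by simp_all
  moreover have "(a0 \<union> b0) \<inter> {x. \<nu> \<notin> x} \<in> \<I>" "(a1 \<union> b1) \<inter> {x. \<nu> \<in> x} \<in> \<I>"
    by (rule set_ideal_sub2 [OF assms ab(4,9)], blast) (rule set_ideal_sub2 [OF assms ab(5,10)], blast)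
  moreover have "a \<union> b \<subseteq> (a0 \<union> b0) \<union> (a1 \<union> b1)" using ab by blast
  ultimately show "a \<union> b \<in> deriv_ideal \<nu> \<I>"
    unfolding deriv_ideal_def by blast
next
  fix a b assume "a \<in> deriv_ideal \<nu> \<I>" "b \<subseteq> a"
  then show "b \<in> deriv_ideal \<nu> \<I>" unfolding deriv_ideal_def by blast
qed

text \<open>Let \<I> code S. If x_\<nu> f = q on S, then q = 0 where \<nu> is off, so
  \<open>?b0\<close> misses that part of S, and f = q where \<nu> is on, so \<open>?b1\<close>
  misses the other part.\<close>

lemma in_deriv_idealI:
  assumes \<I>: "set_ideal \<I>" and f: "depends_on f (below \<nu>)" and q: "depends_on q (below \<nu>)"
    and eq: "{x. of_bool (\<nu> \<in> x) * f x \<noteq> (q x :: int)} \<in> \<I>"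
  shows "{x. f x \<noteq> 0} \<in> deriv_ideal \<nu> \<I>"
proof -
  let ?b0 = "{x. q x \<noteq> 0}" and ?b1 = "{x. f x \<noteq> 0 \<and> q x = 0}"
  have "depends_on (\<lambda>x. x \<in> ?b0) (below \<nu>)" "depends_on (\<lambda>x. x \<in> ?b1) (below \<nu>)"
    using depends_on_map [OF q, of "\<lambda>a. a \<noteq> 0"]
      depends_on_combine [OF f q, of "\<lambda>a b. a \<noteq> 0 \<and> b = 0"] by simp_all
  moreover have "?b0 \<inter> {x. \<nu> \<notin> x} \<in> \<I>" "?b1 \<inter> {x. \<nu> \<in> x} \<in> \<I>"
    by (rule set_ideal_sub [OF \<I> eq]; auto)+
  moreover have "{x. f x \<noteq> 0} \<subseteq> ?b0 \<union> ?b1" by auto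
  ultimately show ?thesis unfolding deriv_ideal_def by blast
qed

text \<open>Cutting f off outside \<open>b0\<close> yields q: on S, the set \<open>b0\<close> has no
  points with \<nu> off, and every point with \<nu> on where f is nonzero lies in \<open>b0\<close>.
  With the converse above, this is exactness in the middle of Noebeling's sequence 0 ->
  C(S_{<\<nu>}) -> C(S_{\<le>\<nu>}) -> C(S_0 \<inter> S_1) -> 0.\<close>

lemma in_deriv_idealD:
  assumes \<I>: "set_ideal \<I>" and f: "depends_on f (below \<nu>)" and Z: "{x. f x \<noteq> 0} \<in> deriv_ideal \<nu> \<I>"
  obtains q where "depends_on q (below \<nu>)" "{x. of_bool (\<nu> \<in> x) * f x \<noteq> (q x :: int)} \<in> \<I>"
proof -
  obtain b0 b1 where b: "depends_on (\<lambda>x. x \<in> b0) (below \<nu>)" "{x. f x \<noteq> 0} \<subseteq> b0 \<union> b1"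
     "b0 \<inter> {x. \<nu> \<notin> x} \<in> \<I>" "b1 \<inter> {x. \<nu> \<in> x} \<in> \<I>"
    using Z unfolding deriv_ideal_def by blast
  let ?q = "\<lambda>x. f x * of_bool (x \<in> b0)"
  have "depends_on ?q (below \<nu>)"
    using depends_on_combine [OF f b(1), of "\<lambda>a b. a * of_bool b"] .
  moreover have "{x. of_bool (\<nu> \<in> x) * f x \<noteq> ?q x} \<in> \<I>"
    by (rule set_ideal_sub2 [OF \<I> b(3,4)]) (use b(2) in auto)
  ultimately show ?thesis using that by blast
qed

text \<open>Noebeling's basis, as a recursion on the largest coordinate of a monomial.\<close>

inductive standard :: "'i set set set \<Rightarrow> 'i set \<Rightarrow> bool" where
  empty: "UNIV \<notin> \<I> \<Longrightarrow> standard \<I> {}"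
| insert: "F \<subseteq> below \<nu> \<Longrightarrow> standard (deriv_ideal \<nu> \<I>) F \<Longrightarrow> standard \<I> (insert \<nu> F)"

lemma standard_finite: "standard \<I> F \<Longrightarrow> finite F"
  by (induction rule: standard.induct) auto

lemma standard_empty_iff: "standard \<I> {} \<longleftrightarrow> UNIV \<notin> \<I>"
  by (subst standard.simps) auto

text \<open>The set \<open>insert \<nu> F\<close> remembers \<nu> only as its largest element, so
  inverting the rule means first identifying the two largest elements.\<close>

lemma standard_insertD:
  assumes "standard \<I> (insert \<nu> F)" "F \<subseteq> below \<nu>"
  shows "standard (deriv_ideal \<nu> \<I>) F"
  using assms(1)
proof cases
  case (insert F' \<nu>')
  have "\<nu> = \<nu>'"
  proof (rule ccontr)
    assume "\<nu> \<noteq> \<nu>'"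
    with insert(1) have "\<nu>' \<in> F" "\<nu> \<in> F'" by (metis insertE insertI1)+
    with assms(2) insert(2) have "\<nu>' \<lless> \<nu>" "\<nu> \<lless> \<nu>'" by (auto simp: below_def)
    then show False using trans irrefl by metis
  qed
  moreover have "\<nu> \<notin> F" "\<nu>' \<notin> F'"
    using insert(2) assms(2) irrefl by (auto simp: below_def)
  ultimately have "F = F'" using insert(1) by (metis insert_ident)
  with \<open>\<nu> = \<nu>'\<close> insert(3) show ?thesis by simp
qed auto

section \<open>Existence of normal forms\<close>

definition reduced :: "'i set \<Rightarrow> 'i set set set \<Rightarrow> ('i set \<Rightarrow> int) \<Rightarrow> bool" where
  "reduced D \<I> c \<longleftrightarrow> finite {F. c F \<noteq> 0} \<and> (\<forall>F. c F \<noteq> 0 \<longrightarrow> F \<subseteq> D \<and> standard \<I> F)"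

lemma reduced_depends_on: "reduced D \<I> c \<Longrightarrow> depends_on (lin c) D"
  unfolding reduced_def by (intro depends_on_lin) (auto simp: standard_finite)

text \<open>Stated for any initial segment D, so that one step serves each
  \<open>below \<nu>\<close> and finally \<open>UNIV\<close>, which need not have that form. No
  limit case arises, because f involves finitely many coordinates and hence has a largest one. The
  hypothesis is used twice at this \<nu>, for \<I> and for the derived ideal.\<close>

lemma reduced_exists_step:
  assumes D: "\<And>\<nu>. \<nu> \<in> D \<Longrightarrow> below \<nu> \<subseteq> D"
    and IH: "\<And>\<nu> \<I> f. \<nu> \<in> D \<Longrightarrow> set_ideal \<I> \<Longrightarrow> depends_on f (below \<nu>) \<Longrightarrow>
        \<exists>c. reduced (below \<nu>) \<I> c \<and> {x. f x \<noteq> lin c x} \<in> \<I>"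
    and \<I>: "set_ideal \<I>" and f: "depends_on f D"
  shows "\<exists>c. reduced D \<I> c \<and> {x. f x \<noteq> lin c x} \<in> \<I>"
proof -
  obtain G where G: "finite G" "G \<subseteq> D" "\<And>x. f x = f (x \<inter> G)"
    using f unfolding depends_on_def by blast
  show ?thesis
  proof (cases "G = {}")
    case True
    then have f0: "f x = f {}" for x using G(3) [of x] by simp
    \<comment> \<open>If \<open>UNIV\<close> is in the ideal, every function is congruent to 0;
      otherwise the empty monomial is standard and carries the constant.\<close>
    show ?thesis
    proof (cases "UNIV \<in> \<I>")
      case True
      then have "{x. f x \<noteq> lin (\<lambda>_. 0) x} \<in> \<I>" using set_ideal_sub [OF \<I>] by blast
      moreover have "reduced D \<I> (\<lambda>_. 0)" by (simp add: reduced_def)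
      ultimately show ?thesis by blast
    next
      case False
      let ?c = "\<lambda>F. if F = {} then f {} else 0"
      have supp: "{F. ?c F \<noteq> 0} \<subseteq> {{}}" by auto
      then have "reduced D \<I> ?c"
        unfolding reduced_def using False
        by (auto simp: standard_empty_iff intro: finite_subset split: if_splits)
      moreover have "lin ?c x = f x" for x
        using lin_superset [OF _ supp, of x] f0 [of x] by simp
      ultimately show ?thesis using set_ideal_empty [OF \<I>] by (intro exI [of _ ?c]) simp
    qed
  next
    case False
    with G(1) obtain \<nu> where \<nu>: "\<nu> \<in> G" "\<And>x. x \<in> G \<Longrightarrow> x = \<nu> \<or> x \<lless> \<nu>"
      using finite_has_max by metis
    have \<nu>D: "\<nu> \<in> D" using \<nu> G by blast
    \<comment> \<open>Value with \<nu> switched off, and difference between \<nu> on and \<nu> off: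
      f = a + x_\<nu> b.\<close>
    define a where "a x = f (x \<inter> (G - {\<nu>}))" for x
    define b where "b x = f (insert \<nu> (x \<inter> (G - {\<nu>}))) - a x" for x
    have fab: "f x = a x + of_bool (\<nu> \<in> x) * b x" for x
    proof (cases "\<nu> \<in> x")
      case True
      then have "x \<inter> G = insert \<nu> (x \<inter> (G - {\<nu>}))" using \<nu>(1) by auto
      with G(3) [of x] True show ?thesis by (simp add: a_def b_def)
    next
      case False
      then have "x \<inter> G = x \<inter> (G - {\<nu>})" by auto
      with G(3) [of x] False show ?thesis by (simp add: a_def)
    qed
    have sub: "G - {\<nu>} \<subseteq> below \<nu>" using \<nu> unfolding below_def by blast
    have a: "depends_on a (below \<nu>)"
      by (rule depends_onI [of "G - {\<nu>}"]) (use G(1) sub in \<open>auto simp: a_def\<close>)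
    have b: "depends_on b (below \<nu>)"
      by (rule depends_onI [of "G - {\<nu>}"]) (use G(1) sub in \<open>auto simp: b_def a_def\<close>)
    obtain cb where cb: "reduced (below \<nu>) (deriv_ideal \<nu> \<I>) cb"
        "{x. b x \<noteq> lin cb x} \<in> deriv_ideal \<nu> \<I>"
      using IH [OF \<nu>D set_ideal_deriv [OF \<I>] b] by blast
    have "depends_on (\<lambda>x. b x - lin cb x) (below \<nu>)"
      by (rule depends_on_combine [OF b reduced_depends_on [OF cb(1)]])
    moreover have "{x. b x - lin cb x \<noteq> 0} \<in> deriv_ideal \<nu> \<I>" using cb(2) by simp
    ultimately obtain q where q: "depends_on q (below \<nu>)"
        "{x. of_bool (\<nu> \<in> x) * (b x - lin cb x) \<noteq> q x} \<in> \<I>"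
      using in_deriv_idealD [OF \<I>] by blast
    \<comment> \<open>The error made in reducing b, multiplied by x_\<nu>, is the function q of
      lower coordinates modulo \<I>. It is absorbed into a, which is why a is reduced only after
      b.\<close>
    have "depends_on (\<lambda>x. a x + q x) (below \<nu>)" by (rule depends_on_combine [OF a q(1)])
    then obtain ca where ca: "reduced (below \<nu>) \<I> ca" "{x. a x + q x \<noteq> lin ca x} \<in> \<I>"
      using IH [OF \<nu>D \<I>, of "\<lambda>x. a x + q x"] by blast
    define c where "c F = (if \<nu> \<in> F then cb (F - {\<nu>}) else ca F)" for F
    have ndown: "\<nu> \<notin> F" if "ca F \<noteq> 0 \<or> cb F \<noteq> 0" for F
      using that ca(1) cb(1) irrefl unfolding reduced_def below_def by blast
    have "{F. c F \<noteq> 0} \<subseteq> {F. ca F \<noteq> 0} \<union> insert \<nu> ` {F. cb F \<noteq> 0}"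
    proof
      fix F assume "F \<in> {F. c F \<noteq> 0}"
      then show "F \<in> {F. ca F \<noteq> 0} \<union> insert \<nu> ` {F. cb F \<noteq> 0}"
        by (cases "\<nu> \<in> F") (auto simp: c_def intro!: image_eqI [of _ _ "F - {\<nu>}"])
    qed
    then have finc: "finite {F. c F \<noteq> 0}"
      by (rule finite_subset) (use ca(1) cb(1) in \<open>auto simp: reduced_def\<close>)
    have red: "reduced D \<I> c"
      unfolding reduced_def
    proof (intro conjI allI impI finc)
      fix F assume F: "c F \<noteq> 0"
      have "F \<subseteq> D \<and> standard \<I> F"
      proof (cases "\<nu> \<in> F")
        case True
        with F have *: "cb (F - {\<nu>}) \<noteq> 0" by (simp add: c_def)
        with cb(1) have "F - {\<nu>} \<subseteq> below \<nu>" "standard (deriv_ideal \<nu> \<I>) (F - {\<nu>})"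
          unfolding reduced_def by blast+
        then have "standard \<I> (insert \<nu> (F - {\<nu>}))" by (rule standard.insert)
        then show ?thesis
          using True \<open>F - {\<nu>} \<subseteq> below \<nu>\<close> D [OF \<nu>D] \<nu>D by (auto simp: insert_absorb)
      next
        case False
        then show ?thesis using F ca(1) D [OF \<nu>D] unfolding reduced_def c_def by auto
      qed
      then show "F \<subseteq> D" "standard \<I> F" by auto
    qed
    have "(\<lambda>F. if \<nu> \<in> F then 0 else c F) = ca"
      using ndown by (auto simp: c_def fun_eq_iff)
    moreover have "(\<lambda>F. if \<nu> \<in> F then 0 else c (insert \<nu> F)) = cb"
      using ndown by (auto simp: c_def fun_eq_iff)
    ultimately have lin: "lin c x = lin ca x + of_bool (\<nu> \<in> x) * lin cb x" for x
      using lin_split [OF finc, of x \<nu>] by simp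
    have "{x. f x \<noteq> lin c x} \<in> \<I>"
      by (rule set_ideal_sub2 [OF \<I> ca(2) q(2)]) (auto simp: fab lin algebra_simps)
    with red show ?thesis by blast
  qed
qed

lemma reduced_exists_below:
  "set_ideal \<I> \<Longrightarrow> depends_on f (below \<nu>) \<Longrightarrow> \<exists>c. reduced (below \<nu>) \<I> c \<and> {x. f x \<noteq> lin c x} \<in> \<I>"
proof (induction \<nu> arbitrary: \<I> f rule: wfp_induct_rule [OF wfp])
  case (1 \<nu>)
  show ?case
    by (rule reduced_exists_step [OF _ _ 1(2,3)]) (use 1(1) in \<open>auto simp: below_def intro: trans\<close>)
qed

lemma reduced_exists:
  "set_ideal \<I> \<Longrightarrow> depends_on f UNIV \<Longrightarrow> \<exists>c. reduced UNIV \<I> c \<and> {x. f x \<noteq> lin c x} \<in> \<I>"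
  by (rule reduced_exists_step) (auto intro: reduced_exists_below)

section \<open>Uniqueness of normal forms\<close>

text \<open>If a + x_\<nu> b vanishes modulo \<I>, then x_\<nu> b is a function of lower coordinates
  there, so b vanishes modulo the derived ideal. The monomials of b are standard for that ideal,
  hence b = 0 by induction, and then a = 0 as well.\<close>

lemma reduced_unique_step:
  assumes IH: "\<And>\<nu> \<I> c. \<nu> \<in> D \<Longrightarrow> set_ideal \<I> \<Longrightarrow> reduced (below \<nu>) \<I> c \<Longrightarrow>
        {x. lin c x \<noteq> 0} \<in> \<I> \<Longrightarrow> c = (\<lambda>_. 0)"
    and \<I>: "set_ideal \<I>" and c: "reduced D \<I> c" and zero: "{x. lin c x \<noteq> 0} \<in> \<I>"
  shows "c = (\<lambda>_. 0)"
proof -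
  let ?S = "{F. c F \<noteq> 0}"
  have finS: "finite ?S" and S: "\<And>F. c F \<noteq> 0 \<Longrightarrow> F \<subseteq> D \<and> standard \<I> F"
    using c unfolding reduced_def by blast+
  have finU: "finite (\<Union>?S)" using finS S standard_finite by blast
  show ?thesis
  proof (cases "\<Union>?S = {}")
    case True
    then have sub: "?S \<subseteq> {{}}" by blast
    have "lin c x = c {}" for x using lin_superset [OF _ sub, of x] by simp
    \<comment> \<open>A nonzero constant term makes the empty monomial standard and so keeps
      \<open>UNIV\<close> out of the ideal, yet the combination would then be nonzero
      everywhere.\<close>
    with zero have "c {} = 0" using S [of "{}"] by (auto simp: standard_empty_iff split: if_splits)
    with sub show ?thesis by blast
  next
    case False
    with finU obtain \<nu> where \<nu>: "\<nu> \<in> \<Union>?S" "\<And>x. x \<in> \<Union>?S \<Longrightarrow> x = \<nu> \<or> x \<lless> \<nu>"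
      using finite_has_max by metis
    have \<nu>D: "\<nu> \<in> D" using \<nu>(1) S by blast
    have sub: "F \<subseteq> below \<nu>" if "c F \<noteq> 0 \<or> c (insert \<nu> F) \<noteq> 0" "\<nu> \<notin> F" for F
      using that \<nu>(2) unfolding below_def by blast
    let ?a = "\<lambda>F. if \<nu> \<in> F then 0 else c F" and ?b = "\<lambda>F. if \<nu> \<in> F then 0 else c (insert \<nu> F)"
    have fina: "finite {F. ?a F \<noteq> 0}"
      by (rule finite_subset [OF _ finS]) auto
    have "{F. ?b F \<noteq> 0} \<subseteq> (\<lambda>F. F - {\<nu>}) ` ?S"
    proof
      fix F assume "F \<in> {F. ?b F \<noteq> 0}"
      then show "F \<in> (\<lambda>F. F - {\<nu>}) ` ?S"
        by (intro image_eqI [of _ _ "insert \<nu> F"]) (auto split: if_splits)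
    qed
    then have finb: "finite {F. ?b F \<noteq> 0}" by (rule finite_subset) (simp add: finS)
    have a: "reduced (below \<nu>) \<I> ?a"
      using fina S sub unfolding reduced_def by (auto split: if_splits)
    have b: "reduced (below \<nu>) (deriv_ideal \<nu> \<I>) ?b"
      unfolding reduced_def
    proof (intro conjI allI impI finb)
      fix F assume "?b F \<noteq> 0"
      then have F: "\<nu> \<notin> F" "c (insert \<nu> F) \<noteq> 0" by (auto split: if_splits)
      then show 1: "F \<subseteq> below \<nu>" using sub by blast
      show "standard (deriv_ideal \<nu> \<I>) F"
        using standard_insertD [OF _ 1] S F(2) by blast
    qed
    have split: "lin c x = lin ?a x + of_bool (\<nu> \<in> x) * lin ?b x" for x
      by (rule lin_split [OF finS])
    have "depends_on (\<lambda>x. - lin ?a x) (below \<nu>)"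
      by (rule depends_on_map [OF reduced_depends_on [OF a]])
    moreover have "{x. of_bool (\<nu> \<in> x) * lin ?b x \<noteq> - lin ?a x} \<in> \<I>"
      by (rule set_ideal_sub [OF \<I> zero]) (auto simp: split)
    ultimately have "{x. lin ?b x \<noteq> 0} \<in> deriv_ideal \<nu> \<I>"
      by (rule in_deriv_idealI [OF \<I> reduced_depends_on [OF b]])
    then have b0: "?b = (\<lambda>_. 0)" by (rule IH [OF \<nu>D set_ideal_deriv [OF \<I>] b])
    then have "lin ?b x = 0" for x by (simp add: lin_def)
    then have "{x. lin ?a x \<noteq> 0} \<in> \<I>"
      by (intro set_ideal_sub [OF \<I> zero]) (auto simp: split)
    then have a0: "?a = (\<lambda>_. 0)" by (rule IH [OF \<nu>D \<I> a])
    show ?thesis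
    proof
      fix F
      show "c F = 0"
      proof (cases "\<nu> \<in> F")
        case True
        with fun_cong [OF b0, of "F - {\<nu>}"] show ?thesis by (simp add: insert_absorb)
      next
        case False
        with fun_cong [OF a0, of F] show ?thesis by simp
      qed
    qed
  qed
qed

lemma reduced_unique_below:
  "set_ideal \<I> \<Longrightarrow> reduced (below \<nu>) \<I> c \<Longrightarrow> {x. lin c x \<noteq> 0} \<in> \<I> \<Longrightarrow> c = (\<lambda>_. 0)"
proof (induction \<nu> arbitrary: \<I> c rule: wfp_induct_rule [OF wfp])
  case (1 \<nu>)
  show ?case
    by (rule reduced_unique_step [OF 1(1) 1(2-4)]) (simp_all add: below_def)
qed

lemma reduced_diff:
  assumes "reduced D \<I> c" "reduced D \<I> d"
  shows "reduced D \<I> (\<lambda>F. c F - d F)"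
proof -
  have "{F. c F - d F \<noteq> 0} \<subseteq> {F. c F \<noteq> 0} \<union> {F. d F \<noteq> 0}" by fastforce
  moreover have "finite ({F. c F \<noteq> 0} \<union> {F. d F \<noteq> 0})" using assms by (simp add: reduced_def)
  ultimately have "finite {F. c F - d F \<noteq> 0}" by (rule finite_subset)
  moreover have "F \<subseteq> D \<and> standard \<I> F" if "c F - d F \<noteq> 0" for F
  proof -
    have "c F \<noteq> 0 \<or> d F \<noteq> 0" using that by auto
    then show ?thesis using assms unfolding reduced_def by blast
  qed
  ultimately show ?thesis unfolding reduced_def by blast
qed

lemma lin_reduced_diff:
  "reduced D \<I> c \<Longrightarrow> reduced D \<I> d \<Longrightarrow> lin (\<lambda>F. c F - d F) x = lin c x - lin d x"
  by (rule lin_diff) (auto simp: reduced_def)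

lemma reduced_unique:
  assumes \<I>: "set_ideal \<I>" and c: "reduced UNIV \<I> c" and d: "reduced UNIV \<I> d"
    and eq: "{x. lin c x \<noteq> lin d x} \<in> \<I>"
  shows "c = d"
proof -
  note red = reduced_diff [OF c d]
  have zero: "{x. lin (\<lambda>F. c F - d F) x \<noteq> 0} \<in> \<I>"
    using eq by (simp add: lin_reduced_diff [OF c d])
  have "(\<lambda>F. c F - d F) = (\<lambda>_. 0)"
    by (rule reduced_unique_step [OF _ \<I> red zero]) (rule reduced_unique_below)
  then show ?thesis by (auto simp: fun_eq_iff)
qed

section \<open>Initial coordinates and their dual functionals\<close>

text \<open>All coordinates below t lie in T. Independence therefore gives points y and z of Y that
  agree on the finitely many coordinates deciding \<open>b1\<close>, with t off in y and on in z.
  Then y must lie in \<open>b1\<close>, hence so does z, which \<open>b1\<close> excludes. Without T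
  initial, \<open>b1\<close> could use coordinates about which nothing is known.\<close>

lemma standard_singleton:
  assumes init: "\<And>x. x \<lless> t \<Longrightarrow> x \<in> T" and t: "t \<in> T"
    and indep: "\<And>G H. finite G \<Longrightarrow> G \<subseteq> T \<Longrightarrow> H \<subseteq> G \<Longrightarrow> \<exists>y\<in>Y. y \<inter> G = H"
  shows "standard {Z. Z \<inter> Y = {}} {t}"
proof (rule standard.insert)
  define \<I> where "\<I> = {Z. Z \<inter> Y = {}}"
  have "UNIV \<notin> deriv_ideal t \<I>"
  proof
    assume "UNIV \<in> deriv_ideal t \<I>"
    then obtain b0 b1 where b: "depends_on (\<lambda>x. x \<in> b0) (below t)" "depends_on (\<lambda>x. x \<in> b1) (below t)"
      and cover: "UNIV \<subseteq> b0 \<union> b1"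
      and \<I>: "b0 \<inter> {x. t \<notin> x} \<in> \<I>" "b1 \<inter> {x. t \<in> x} \<in> \<I>"
      unfolding deriv_ideal_def by blast
    have b0: "t \<in> x" if "x \<in> b0" "x \<in> Y" for x using that \<I>(1) unfolding \<I>_def by blast
    have b1: "t \<notin> x" if "x \<in> b1" "x \<in> Y" for x using that \<I>(2) unfolding \<I>_def by blast
    obtain G where G: "finite G" "G \<subseteq> below t" "\<And>x. x \<in> b1 \<longleftrightarrow> x \<inter> G \<in> b1"
      using b(2) unfolding depends_on_def by blast
    have fin: "finite (insert t G)" and sub: "insert t G \<subseteq> T"
      using G init t unfolding below_def by auto
    have "t \<notin> G" using G(2) irrefl unfolding below_def by blast
    obtain y where y: "y \<in> Y" "y \<inter> insert t G = {}" using indep [OF fin sub, of "{}"] by blast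
    obtain z where z: "z \<in> Y" "z \<inter> insert t G = {t}" using indep [OF fin sub, of "{t}"] by blast
    have "t \<notin> y" "t \<in> z" using y z by auto
    then have "y \<in> b1" using b0 [OF _ y(1)] cover by blast
    have "y \<inter> G = {}" using y(2) by blast
    moreover have "z \<inter> G = {}" using z(2) \<open>t \<notin> G\<close> by auto
    ultimately have "z \<in> b1" using \<open>y \<in> b1\<close> by (metis G(3))
    then show False using b1 [OF _ z(1)] \<open>t \<in> z\<close> by blast
  qed
  then show "standard (deriv_ideal t {Z. Z \<inter> Y = {}}) {}"
    unfolding standard_empty_iff \<I>_def .
qed simp

text \<open>\<open>R f t\<close> is the coefficient of the monomial {t} in the normal form of f on
  Y. Additivity is stated for equations that hold on Y only, which treats f as an element of C(Y, Z)
  without constructing that group.\<close>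

lemma dual_functionals_of_initial:
  assumes init: "\<And>x t. t \<in> T \<Longrightarrow> x \<lless> t \<Longrightarrow> x \<in> T"
    and indep: "\<And>G H. finite G \<Longrightarrow> G \<subseteq> T \<Longrightarrow> H \<subseteq> G \<Longrightarrow> \<exists>y\<in>Y. y \<inter> G = H"
  obtains R :: "('i set \<Rightarrow> int) \<Rightarrow> 'i \<Rightarrow> int" where
    "\<And>f. depends_on f UNIV \<Longrightarrow> finite {t. R f t \<noteq> 0}"
    "\<And>f g h t. depends_on f UNIV \<Longrightarrow> depends_on g UNIV \<Longrightarrow> depends_on h UNIV \<Longrightarrow>
       (\<And>y. y \<in> Y \<Longrightarrow> f y = g y + h y) \<Longrightarrow> R f t = R g t + R h t"
    "\<And>f s t. s \<in> T \<Longrightarrow> depends_on f UNIV \<Longrightarrow> (\<And>y. y \<in> Y \<Longrightarrow> f y = of_bool (s \<in> y)) \<Longrightarrow>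
       R f t = of_bool (s = t)"
proof -
  let ?I = "{Z. Z \<inter> Y = {}}"
  let ?P = "\<lambda>f c. reduced UNIV ?I c \<and> (\<forall>y\<in>Y. f y = lin c y)"
  have \<I>: "set_ideal ?I" unfolding set_ideal_def by blast
  define C where "C f = (SOME c. ?P f c)" for f
  have C: "?P f (C f)" if f: "depends_on f UNIV" for f
  proof -
    obtain c where "reduced UNIV ?I c" "{x. f x \<noteq> lin c x} \<in> ?I"
      using reduced_exists [OF \<I> f] by blast
    then have "?P f c" by blast
    then show ?thesis unfolding C_def by (rule someI [of "?P f"])
  qed
  have uniq: "c = d" if "reduced UNIV ?I c" "reduced UNIV ?I d" "\<forall>y\<in>Y. lin c y = lin d y" for c d
    by (rule reduced_unique [OF \<I> that(1,2)]) (use that(3) in blast)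
  have 1: "finite {t. C f {t} \<noteq> 0}" if f: "depends_on f UNIV" for f
  proof -
    have "finite {F. C f F \<noteq> 0}" using C [OF f] unfolding reduced_def by blast
    then have "finite ((\<lambda>t. {t}) -` {F. C f F \<noteq> 0})" by (rule finite_vimageI) simp
    then show ?thesis by (simp add: vimage_def)
  qed
  have 2: "C f {t} = C g {t} + C h {t}" if asm: "depends_on f UNIV" "depends_on g UNIV" "depends_on h UNIV"
      "\<And>y. y \<in> Y \<Longrightarrow> f y = g y + h y" for f g h t
  proof -
    have "(\<lambda>F. C f F - C g F) = C h"
    proof (rule uniq)
      have "lin (\<lambda>F. C f F - C g F) y = lin (C h) y" if "y \<in> Y" for y
      proof -
        have "lin (\<lambda>F. C f F - C g F) y = lin (C f) y - lin (C g) y"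
          by (rule lin_reduced_diff) (use C [OF asm(1)] C [OF asm(2)] in blast)+
        also have "\<dots> = f y - g y" using C [OF asm(1)] C [OF asm(2)] \<open>y \<in> Y\<close> by simp
        also have "\<dots> = lin (C h) y" using C [OF asm(3)] asm(4) \<open>y \<in> Y\<close> by simp
        finally show ?thesis .
      qed
      then show "\<forall>y\<in>Y. lin (\<lambda>F. C f F - C g F) y = lin (C h) y" by blast
      show "reduced UNIV ?I (\<lambda>F. C f F - C g F)"
        by (rule reduced_diff) (use C [OF asm(1)] C [OF asm(2)] in blast)+
      show "reduced UNIV ?I (C h)" using C [OF asm(3)] by blast
    qed
    then have "C f {t} - C g {t} = C h {t}" by (rule fun_cong)
    then show ?thesis by simp
  qed
  have 3: "C f {t} = of_bool (s = t)" if s: "s \<in> T" and f: "depends_on f UNIV"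
      "\<And>y. y \<in> Y \<Longrightarrow> f y = of_bool (s \<in> y)" for f s t
  proof -
    have std: "standard ?I {s}"
      by (rule standard_singleton [OF _ s]) (rule init [OF s], assumption, rule indep)
    \<comment> \<open>The coordinate function of s is already a normal form, since its only monomial
      is standard.\<close>
    let ?c = "\<lambda>F. of_bool (F = {s}) :: int"
    have supp: "{F. ?c F \<noteq> 0} \<subseteq> {{s}}" by auto
    then have "finite {F. ?c F \<noteq> 0}" by (rule finite_subset) simp
    then have "reduced UNIV ?I ?c"
      unfolding reduced_def using std by auto
    moreover have "lin ?c y = of_bool (s \<in> y)" for y
      using lin_superset [OF _ supp, of y] by simp
    ultimately have "C f = ?c" using C [OF f(1)] f(2) by (intro uniq) auto
    then show ?thesis by auto
  qed
  show ?thesis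
    by (rule that [of "\<lambda>f t. C f {t}"]) (fact 1, fact 2, fact 3)
qed

end

text \<open>Any well-order, preceded lexicographically by a two-valued rank that is 0 exactly on
  T.\<close>

lemma strict_wellorder_with_initial_set:
  obtains less :: "'i \<Rightarrow> 'i \<Rightarrow> bool" where "strict_wellorder less"
    and "\<And>x t. t \<in> T \<Longrightarrow> less x t \<Longrightarrow> x \<in> T"
proof -
  obtain r :: "'i rel" where r: "well_order_on UNIV r" using well_order_on by blast
  have lin: "linear_order_on UNIV r" and wf: "wf (r - Id)" using r unfolding well_order_on_def by auto
  have tr: "trans r" and as: "antisym r" and tot: "total r"
    using lin unfolding linear_order_on_def partial_order_on_def preorder_on_def by auto
  let ?f = "\<lambda>x. (of_bool (x \<notin> T) :: nat, x)"
  define less where "less x y \<longleftrightarrow> (?f x, ?f y) \<in> less_than <*lex*> (r - Id)" for x y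
  have "strict_wellorder less"
  proof
    have "wf (inv_image (less_than <*lex*> (r - Id)) ?f)"
      by (intro wf_inv_image wf_lex_prod wf_less_than wf)
    then show "wfp less" by (simp add: wfp_def less_def inv_image_def)
  next
    fix x y z assume "less x y" "less y z"
    then show "less x z" using tr as unfolding less_def trans_def antisym_def by auto
  next
    fix x y show "less x y \<or> x = y \<or> less y x"
      using tot unfolding less_def total_on_def by auto
  qed
  moreover have "x \<in> T" if "t \<in> T" "less x t" for x t
    using that by (auto simp: less_def split: if_splits)
  ultimately show ?thesis using that by blast
qed

text \<open>The well-order serves only to choose a basis and is discharged here.\<close>

lemma dual_functionals:
  assumes "\<And>G H. finite G \<Longrightarrow> G \<subseteq> T \<Longrightarrow> H \<subseteq> G \<Longrightarrow> \<exists>y\<in>Y. y \<inter> G = H"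
  obtains R :: "('i set \<Rightarrow> int) \<Rightarrow> 'i \<Rightarrow> int" where
    "\<And>f. depends_on f UNIV \<Longrightarrow> finite {t. R f t \<noteq> 0}"
    "\<And>f g h t. depends_on f UNIV \<Longrightarrow> depends_on g UNIV \<Longrightarrow> depends_on h UNIV \<Longrightarrow>
       (\<And>y. y \<in> Y \<Longrightarrow> f y = g y + h y) \<Longrightarrow> R f t = R g t + R h t"
    "\<And>f s t. s \<in> T \<Longrightarrow> depends_on f UNIV \<Longrightarrow> (\<And>y. y \<in> Y \<Longrightarrow> f y = of_bool (s \<in> y)) \<Longrightarrow>
       R f t = of_bool (s = t)"
proof -
  obtain less :: "'i \<Rightarrow> 'i \<Rightarrow> bool" where less: "strict_wellorder less"
    and init: "\<And>x t. t \<in> T \<Longrightarrow> less x t \<Longrightarrow> x \<in> T"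
    using strict_wellorder_with_initial_set [of T] by metis
  show ?thesis
    by (rule strict_wellorder.dual_functionals_of_initial [OF less, of T Y])
      (fact init, fact assms, fact that)
qed

section \<open>Free abelian groups\<close>

lemma int_combination_superset:
  fixes G (structure)
  assumes G: "comm_group G" and B: "B \<subseteq> carrier G" "finite B" "Poly_Mapping.keys c \<subseteq> B"
  shows "int_combination G c = finprod G (\<lambda>b. b [^]\<^bsub>G\<^esub> Poly_Mapping.lookup c b) B"
proof -
  interpret comm_group G by fact
  show ?thesis
    unfolding int_combination_def
    by (rule finprod_mono_neutral_cong_left) (use B in \<open>auto simp: in_keys_iff\<close>)
qed

lemma int_combination_closed:
  assumes G: "comm_group G" and "Poly_Mapping.keys c \<subseteq> carrier G"
  shows "int_combination G c \<in> carrier G"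
proof -
  interpret comm_group G by fact
  show ?thesis unfolding int_combination_def by (rule finprod_closed) (use assms(2) in auto)
qed

lemma int_combination_add:
  fixes G (structure)
  assumes G: "comm_group G" and cd: "Poly_Mapping.keys c \<subseteq> carrier G" "Poly_Mapping.keys d \<subseteq> carrier G"
  shows "int_combination G (c + d) = int_combination G c \<otimes>\<^bsub>G\<^esub> int_combination G d"
proof -
  interpret comm_group G by fact
  let ?B = "Poly_Mapping.keys c \<union> Poly_Mapping.keys d"
  have B: "?B \<subseteq> carrier G" "finite ?B" using cd by auto
  have "int_combination G (c + d)
      = (\<Otimes>b\<in>?B. b [^] Poly_Mapping.lookup c b \<otimes> b [^] Poly_Mapping.lookup d b)"
    unfolding int_combination_superset [OF G B keys_add]
    by (rule finprod_cong') (use B in \<open>auto simp: lookup_add int_pow_mult\<close>)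
  also have "\<dots> = (\<Otimes>b\<in>?B. b [^] Poly_Mapping.lookup c b) \<otimes> (\<Otimes>b\<in>?B. b [^] Poly_Mapping.lookup d b)"
    by (rule finprod_multf) (use B in auto)
  also have "\<dots> = int_combination G c \<otimes> int_combination G d"
    by (simp only: int_combination_superset [OF G B Un_upper1] int_combination_superset [OF G B Un_upper2])
  finally show ?thesis .
qed

lemma int_combination_hom:
  assumes G: "comm_group G" and B: "B \<subseteq> carrier G"
  shows "int_combination G \<in> hom (free_Abelian_group B) G"
  using B by (intro homI) (auto intro!: int_combination_closed [OF G] int_combination_add [OF G])

lemma int_combination_diff:
  fixes G (structure)
  assumes G: "comm_group G" and cd: "Poly_Mapping.keys c \<subseteq> carrier G" "Poly_Mapping.keys d \<subseteq> carrier G"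
  shows "int_combination G (c - d) = int_combination G c \<otimes>\<^bsub>G\<^esub> inv\<^bsub>G\<^esub> int_combination G d"
proof -
  interpret comm_group G by fact
  interpret group_hom "free_Abelian_group (carrier G)" G "int_combination G"
    by (intro group_hom.intro group_hom_axioms.intro int_combination_hom G) auto
  have "int_combination G (- d) = inv int_combination G d"
    using hom_inv [of d] cd by simp
  with int_combination_add [OF G, of c "- d"] cd show ?thesis by simp
qed

lemma int_combination_zero: "comm_group G \<Longrightarrow> int_combination G 0 = \<one>\<^bsub>G\<^esub>"
  by (simp add: int_combination_def comm_group_def comm_monoid.finprod_empty)

lemma int_combination_cmul_frag_of:
  assumes G: "comm_group G" and b: "b \<in> carrier G"
  shows "int_combination G (frag_cmul n (frag_of b)) = b [^]\<^bsub>G\<^esub> n"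
proof -
  interpret comm_group G by fact
  have sub: "Poly_Mapping.keys (frag_cmul n (frag_of b)) \<subseteq> {b}" by auto
  show ?thesis
    using int_combination_superset [OF G _ _ sub] b by simp
qed

lemma hom_int_combination:
  fixes G (structure)
  assumes G: "comm_group G" and \<phi>: "\<phi> \<in> hom G integer_group" and c: "Poly_Mapping.keys c \<subseteq> carrier G"
  shows "\<phi> (int_combination G c) = (\<Sum>b\<in>Poly_Mapping.keys c. Poly_Mapping.lookup c b * \<phi> b)"
proof -
  interpret comm_group G by fact
  interpret group_hom G integer_group \<phi>
    by (intro group_hom.intro group_hom_axioms.intro \<phi>) auto
  have "\<phi> (finprod G (\<lambda>b. b [^] Poly_Mapping.lookup c b) B) = (\<Sum>b\<in>B. Poly_Mapping.lookup c b * \<phi> b)"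
    if "finite B" "B \<subseteq> carrier G" for B
    using that
  proof (induction B rule: finite_induct)
    case empty
    then show ?case using hom_one by simp
  next
    case (insert b B)
    then have *: "(\<lambda>b. b [^] Poly_Mapping.lookup c b) \<in> B \<rightarrow> carrier G" by auto
    with insert show ?case
      by (simp add: hom_mult finprod_closed hom_int_pow)
  qed
  with c show ?thesis unfolding int_combination_def by simp
qed

lemma is_basisI:
  fixes G (structure)
  assumes G: "comm_group G" and B: "B \<subseteq> carrier G"
    and span: "\<And>x. x \<in> carrier G \<Longrightarrow> \<exists>c. Poly_Mapping.keys c \<subseteq> B \<and> int_combination G c = x"
    and indep: "\<And>c. Poly_Mapping.keys c \<subseteq> B \<Longrightarrow> int_combination G c = \<one>\<^bsub>G\<^esub> \<Longrightarrow> c = 0"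
  shows "is_basis G B"
proof -
  interpret comm_group G by fact
  have "c = d" if c: "Poly_Mapping.keys c \<subseteq> B" and d: "Poly_Mapping.keys d \<subseteq> B"
    and eq: "int_combination G c = int_combination G d" for c d
  proof -
    have "int_combination G (c - d) = \<one>"
      using int_combination_diff [OF G] int_combination_closed [OF G] c d B eq by (simp add: subset_trans)
    moreover have "Poly_Mapping.keys (c - d) \<subseteq> B" using keys_diff [of c d] c d by blast
    ultimately have "c - d = 0" by (intro indep)
    then show ?thesis by simp
  qed
  then show ?thesis
    unfolding is_basis_def using B span by (simp add: Ex1_def) metis
qed

section \<open>Coordinates with respect to a basis, and subgroups of free abelian groups\<close>

definition coordinates :: "('a, 'm) monoid_scheme \<Rightarrow> 'a set \<Rightarrow> 'a \<Rightarrow> ('a \<Rightarrow>\<^sub>0 int)" where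
  "coordinates G B x = (THE c. Poly_Mapping.keys c \<subseteq> B \<and> int_combination G c = x)"

lemma coordinates_props:
  assumes "is_basis G B" "x \<in> carrier G"
  shows "Poly_Mapping.keys (coordinates G B x) \<subseteq> B \<and> int_combination G (coordinates G B x) = x"
  unfolding coordinates_def
  by (rule theI') (use assms in \<open>simp add: is_basis_def\<close>)

lemma coordinates_eqI:
  assumes "is_basis G B" "x \<in> carrier G" "Poly_Mapping.keys c \<subseteq> B" "int_combination G c = x"
  shows "coordinates G B x = c"
proof -
  have "\<exists>!c. Poly_Mapping.keys c \<subseteq> B \<and> int_combination G c = x"
    using assms(1,2) by (simp add: is_basis_def)
  then show ?thesis using coordinates_props [OF assms(1,2)] assms(3,4) by blast
qed

lemma coordinates_mult:
  fixes G (structure)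
  assumes G: "comm_group G" and B: "is_basis G B" and xy: "x \<in> carrier G" "y \<in> carrier G"
  shows "coordinates G B (x \<otimes>\<^bsub>G\<^esub> y) = coordinates G B x + coordinates G B y"
proof -
  interpret comm_group G by fact
  have "B \<subseteq> carrier G" using B by (simp add: is_basis_def)
  with coordinates_props [OF B] xy
  have "int_combination G (coordinates G B x + coordinates G B y) = x \<otimes> y"
    by (subst int_combination_add [OF G]) (auto intro: subset_trans)
  moreover have "Poly_Mapping.keys (coordinates G B x + coordinates G B y) \<subseteq> B"
    using keys_add [of "coordinates G B x" "coordinates G B y"] coordinates_props [OF B] xy by blast
  ultimately show ?thesis by (intro coordinates_eqI [OF B] m_closed xy)
qed

lemma coordinates_basis:
  assumes G: "comm_group G" and B: "is_basis G B" and b: "b \<in> B"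
  shows "coordinates G B b = frag_of b"
proof (rule coordinates_eqI [OF B])
  interpret comm_group G by fact
  show "b \<in> carrier G" using B b by (auto simp: is_basis_def)
  then show "int_combination G (frag_of b) = b"
    using int_combination_cmul_frag_of [OF G, of b 1] by simp
qed (use b in simp)

text \<open>A basis is read off from leading terms: for each index \<open>\<nu>\<close> one element whose coordinate
  at \<open>\<nu>\<close> generates the group of all \<open>\<nu>\<close>-th coordinates of elements with leading index at most \<open>\<nu>\<close>.\<close>

lemma (in strict_wellorder) is_free_abelian_of_embedding:
  fixes A :: "('a, 'm) monoid_scheme" (structure) and h :: "'a \<Rightarrow> ('i \<Rightarrow>\<^sub>0 int)"
  assumes A: "comm_group A"
    and h_mult: "\<And>x y. x \<in> carrier A \<Longrightarrow> y \<in> carrier A \<Longrightarrow> h (x \<otimes>\<^bsub>A\<^esub> y) = h x + h y"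
    and h_inj: "\<And>x. x \<in> carrier A \<Longrightarrow> h x = 0 \<Longrightarrow> x = \<one>\<^bsub>A\<^esub>"
  shows "is_free_abelian A"
proof -
  interpret comm_group A by fact
  define l where "l \<nu> x = Poly_Mapping.lookup (h x) \<nu>" for \<nu> x
  have l: "l \<nu> \<in> hom A integer_group" for \<nu>
    by (rule homI) (simp_all add: l_def h_mult lookup_add)
  interpret l: group_hom A integer_group "l \<nu>" for \<nu>
    by (intro group_hom.intro group_hom_axioms.intro l) auto
  have l_simps: "l \<nu> (x \<otimes> y) = l \<nu> x + l \<nu> y" "l \<nu> \<one> = 0" "l \<nu> (inv x) = - l \<nu> x" "l \<nu> (x [^] n) = n * l \<nu> x"
    if "x \<in> carrier A" "y \<in> carrier A" for \<nu> x y and n :: int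
    using that l.hom_mult l.hom_one l.hom_inv l.hom_int_pow by simp_all
  have one: "x = \<one>" if "x \<in> carrier A" "\<And>\<mu>. l \<mu> x = 0" for x
    by (rule h_inj [OF that(1)]) (use that(2) in \<open>auto simp: l_def poly_mapping_eq_iff fun_eq_iff\<close>)
  define H where "H \<nu> = {x \<in> carrier A. \<forall>\<mu>. \<nu> \<lless> \<mu> \<longrightarrow> l \<mu> x = 0}" for \<nu>
  have lead: "\<exists>\<mu>. x \<in> H \<mu> \<and> l \<mu> x \<noteq> 0" if x: "x \<in> carrier A" "x \<noteq> \<one>" for x
  proof -
    have "Poly_Mapping.keys (h x) \<noteq> {}" using h_inj x by auto
    then obtain \<mu> where \<mu>: "\<mu> \<in> Poly_Mapping.keys (h x)" "\<And>y. y \<in> Poly_Mapping.keys (h x) \<Longrightarrow> y = \<mu> \<or> y \<lless> \<mu>"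
      using finite_has_max [OF finite_keys] by metis
    have "x \<in> H \<mu>" unfolding H_def l_def
      using x \<mu>(2) trans irrefl by (auto simp: in_keys_iff) (metis in_keys_iff)
    then show ?thesis using \<mu>(1) by (auto simp: l_def in_keys_iff)
  qed
  \<comment> \<open>The \<nu>-th coordinates of \<open>H \<nu>\<close> form an ideal of Z. N
    collects the \<nu> for which it is nonzero, \<open>d \<nu>\<close> is its positive generator,
    and \<open>g \<nu>\<close> attains this value.\<close>
  define P where "P \<nu> n \<longleftrightarrow> 0 < n \<and> (\<exists>x\<in>H \<nu>. l \<nu> x = int n)" for \<nu> n
  define N where "N = {\<nu>. \<exists>n. P \<nu> n}"
  define d where "d \<nu> = (LEAST n. P \<nu> n)" for \<nu>
  define g where "g \<nu> = (SOME x. x \<in> H \<nu> \<and> l \<nu> x = int (d \<nu>))" for \<nu>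
  have d: "P \<nu> (d \<nu>)" if "\<nu> \<in> N" for \<nu>
    using that unfolding N_def d_def by (auto intro: LeastI)
  have g: "g \<nu> \<in> H \<nu> \<and> l \<nu> (g \<nu>) = int (d \<nu>)" if "\<nu> \<in> N" for \<nu>
    unfolding g_def by (rule someI_ex) (use d [OF that] in \<open>auto simp: P_def\<close>)
  have H_pow: "x \<otimes> inv (y [^] n) \<in> H \<nu>" if "x \<in> H \<nu>" "y \<in> H \<nu>" for x y \<nu> and n :: int
    using that unfolding H_def by (auto simp: l_simps)
  \<comment> \<open>Division with remainder by \<open>d \<nu>\<close>: a nonzero remainder would
    contradict minimality. For \<nu> outside N the coordinate is 0 on all of \<open>H \<nu>\<close>,
    and b = \<open>\<one>\<close> is a dummy.\<close>
  have step: "\<exists>q. \<exists>b\<in>carrier A. (b = \<one> \<or> \<nu> \<in> N \<and> b = g \<nu>) \<and> b \<in> H \<nu> \<and> l \<nu> x = q * l \<nu> b" if x: "x \<in> H \<nu>" for x \<nu>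
  proof (cases "\<nu> \<in> N")
    case True
    have d0: "0 < d \<nu>" using d [OF True] by (simp add: P_def)
    let ?q = "l \<nu> x div int (d \<nu>)"
    let ?y = "x \<otimes> inv (g \<nu> [^] ?q)"
    have gc: "g \<nu> \<in> carrier A" "x \<in> carrier A" using g [OF True] x by (auto simp: H_def)
    have "l \<nu> ?y = l \<nu> x mod int (d \<nu>)"
      using gc g [OF True] by (simp add: l_simps minus_div_mult_eq_mod)
    moreover have "?y \<in> H \<nu>" using H_pow x g [OF True] by blast
    moreover have "\<not> P \<nu> (nat (l \<nu> x mod int (d \<nu>)))"
      unfolding d_def
    proof (rule not_less_Least)
      show "nat (l \<nu> x mod int (LEAST n. P \<nu> n)) < (LEAST n. P \<nu> n)"
        using d0 unfolding d_def by (simp add: nat_less_iff)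
    qed
    ultimately have "l \<nu> x mod int (d \<nu>) = 0"
      using d0 unfolding P_def by (auto simp: not_less) (smt (verit) Euclidean_Rings.pos_mod_sign of_nat_0_less_iff)
    then have "l \<nu> x = ?q * l \<nu> (g \<nu>)" using g [OF True] by (metis mult.commute mult_div_mod_eq add.right_neutral)
    then show ?thesis using True gc g [OF True] by blast
  next
    case False
    have "l \<nu> x = 0"
    proof (rule ccontr)
      assume "l \<nu> x \<noteq> 0"
      then have "P \<nu> (nat \<bar>l \<nu> x\<bar>)"
        unfolding P_def using x H_pow [OF _ x, of \<one> 1]
        by (cases "l \<nu> x > 0") (auto simp: l_simps H_def intro!: bexI [of _ x] bexI [of _ "inv x"])
      with False show False by (auto simp: N_def)
    qed
    then show ?thesis by (intro exI [of _ 0] bexI [of _ \<one>]) (auto simp: H_def l_simps)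
  qed
  let ?B = "g ` N"
  have B: "?B \<subseteq> carrier A" using g by (auto simp: H_def)
  have span_H: "\<exists>c. Poly_Mapping.keys c \<subseteq> ?B \<and> int_combination A c = x" if "x \<in> H \<nu>" for x \<nu>
    using that
  proof (induction \<nu> arbitrary: x rule: wfp_induct_rule [OF wfp])
    case (1 \<nu>)
    obtain q b where b: "b \<in> carrier A" "b = \<one> \<or> \<nu> \<in> N \<and> b = g \<nu>" "b \<in> H \<nu>" "l \<nu> x = q * l \<nu> b"
      using step [OF 1(2)] by blast
    have x: "x \<in> carrier A" using 1(2) by (simp add: H_def)
    \<comment> \<open>Dividing out the power of b clears coordinate \<nu>, so y is trivial or its
      leading index is strictly below \<nu>.\<close>
    define y where "y = x \<otimes> inv (b [^] q)"
    have y: "y \<in> H \<nu>" "y \<in> carrier A" unfolding y_def using H_pow [OF 1(2) b(3)] by (auto simp: H_def)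
    have ly: "l \<nu> y = 0" unfolding y_def using b x by (simp add: l_simps)
    have "\<exists>c. Poly_Mapping.keys c \<subseteq> ?B \<and> int_combination A c = y"
    proof (cases "y = \<one>")
      case True
      then show ?thesis by (intro exI [of _ 0]) (simp add: int_combination_zero [OF A])
    next
      case False
      then obtain \<mu> where \<mu>: "y \<in> H \<mu>" "l \<mu> y \<noteq> 0" using lead y(2) by blast
      then have "\<mu> \<noteq> \<nu>" "\<not> \<nu> \<lless> \<mu>" using ly y(1) by (auto simp: H_def)
      then have "\<mu> \<lless> \<nu>" using total by blast
      then show ?thesis using 1(1) \<mu>(1) by blast
    qed
    then obtain c where c: "Poly_Mapping.keys c \<subseteq> ?B" "int_combination A c = y" by blast
    have "b [^] q = \<one> \<or> b \<in> ?B" using b(2) by auto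
    then obtain e where e: "Poly_Mapping.keys e \<subseteq> ?B" "int_combination A e = b [^] q"
    proof
      assume "b [^] q = \<one>"
      then show ?thesis by (intro that [of 0]) (simp_all add: int_combination_zero [OF A])
    next
      assume "b \<in> ?B"
      then show ?thesis
        by (intro that [of "frag_cmul q (frag_of b)"]) (auto simp: int_combination_cmul_frag_of [OF A b(1)])
    qed
    have "int_combination A (c + e) = y \<otimes> b [^] q"
      using c e B by (subst int_combination_add [OF A]) (auto intro: subset_trans)
    also have "\<dots> = x" unfolding y_def using x b(1) by (simp add: m_assoc)
    finally show ?case using keys_add [of c e] c(1) e(1) by blast
  qed
  have "is_basis A ?B"
  proof (rule is_basisI [OF A B])
    fix x assume "x \<in> carrier A"
    then show "\<exists>c. Poly_Mapping.keys c \<subseteq> ?B \<and> int_combination A c = x"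
      using lead [of x] span_H int_combination_zero [OF A] by (cases "x = \<one>") (auto intro: exI [of _ 0])
  next
    fix c assume c: "Poly_Mapping.keys c \<subseteq> ?B" "int_combination A c = \<one>"
    show "c = 0"
    proof (rule ccontr)
      assume "c \<noteq> 0"
      define M where "M = {\<nu> \<in> N. g \<nu> \<in> Poly_Mapping.keys c}"
      have ginj: "inj_on g N"
      proof (rule inj_onI, rule ccontr)
        fix \<mu> \<nu> assume \<mu>\<nu>: "\<mu> \<in> N" "\<nu> \<in> N" "g \<mu> = g \<nu>" "\<mu> \<noteq> \<nu>"
        have "l \<mu> (g \<mu>) \<noteq> 0" "l \<nu> (g \<nu>) \<noteq> 0"
          using g [OF \<mu>\<nu>(1)] g [OF \<mu>\<nu>(2)] d [OF \<mu>\<nu>(1)] d [OF \<mu>\<nu>(2)] by (auto simp: P_def)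
        then show False using g [OF \<mu>\<nu>(1)] g [OF \<mu>\<nu>(2)] total [of \<mu> \<nu>] \<mu>\<nu>(3,4) by (auto simp: H_def)
      qed
      have "finite (g ` M)" by (rule finite_subset [OF _ finite_keys [of c]]) (auto simp: M_def)
      moreover have "inj_on g M" using ginj by (rule inj_on_subset) (auto simp: M_def)
      ultimately have "finite M" by (rule finite_imageD)
      moreover have "M \<noteq> {}"
      proof -
        obtain b where "b \<in> Poly_Mapping.keys c" using \<open>c \<noteq> 0\<close> keys_eq_empty by blast
        then show ?thesis using c(1) by (auto simp: M_def)
      qed
      ultimately obtain \<nu> where \<nu>: "\<nu> \<in> M" "\<And>\<mu>. \<mu> \<in> M \<Longrightarrow> \<mu> = \<nu> \<or> \<mu> \<lless> \<nu>"
        using finite_has_max by metis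
      \<comment> \<open>At the largest index \<nu> of the combination only \<open>g \<nu>\<close>
        has a nonzero coordinate, as the other \<open>g \<mu>\<close> have \<mu> below
        \<nu>.\<close>
      have other: "Poly_Mapping.lookup c b * l \<nu> b = 0" if b: "b \<in> Poly_Mapping.keys c - {g \<nu>}" for b
      proof -
        obtain \<mu> where \<mu>: "\<mu> \<in> N" "b = g \<mu>" using b c(1) by blast
        then have "\<mu> \<lless> \<nu>" using \<nu>(2) [of \<mu>] b by (auto simp: M_def)
        then show ?thesis using g [OF \<mu>(1)] \<mu>(2) by (simp add: H_def)
      qed
      have "0 = l \<nu> (int_combination A c)" using l_simps(2) c(2) by simp
      also have "\<dots> = (\<Sum>b\<in>Poly_Mapping.keys c. Poly_Mapping.lookup c b * l \<nu> b)"
        by (rule hom_int_combination [OF A l]) (use c(1) B in blast)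
      also have "\<dots> = (\<Sum>b\<in>{g \<nu>}. Poly_Mapping.lookup c b * l \<nu> b)"
        by (rule sum.mono_neutral_right) (use \<nu>(1) other in \<open>auto simp: M_def\<close>)
      also have "\<dots> \<noteq> 0"
        using \<nu>(1) g [of \<nu>] d [of \<nu>] by (auto simp: M_def P_def in_keys_iff)
      finally show False by simp
    qed
  qed
  with A show ?thesis unfolding is_free_abelian_def by blast
qed

text \<open>Subgroups of free abelian groups are free: j followed by the coordinates of a basis of F
  embeds A into finitely supported integer functions on a well-ordered set.\<close>

lemma is_free_abelian_of_injective_hom:
  fixes A (structure) and F :: "('f, 'n) monoid_scheme"
  assumes A: "comm_group A" and F: "is_free_abelian F" and j: "j \<in> hom A F" "inj_on j (carrier A)"
  shows "is_free_abelian A"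
proof -
  obtain B where B: "comm_group F" "is_basis F B" using F unfolding is_free_abelian_def by blast
  interpret comm_group A by fact
  interpret F: comm_group F by fact
  interpret j: group_hom A F j by (intro group_hom.intro group_hom_axioms.intro j) auto
  obtain less :: "'f \<Rightarrow> 'f \<Rightarrow> bool" where "strict_wellorder less"
    using strict_wellorder_with_initial_set [of UNIV] by metis
  then show ?thesis
  proof (rule strict_wellorder.is_free_abelian_of_embedding [OF _ A, of _ "\<lambda>x. coordinates F B (j x)"])
    fix x y assume "x \<in> carrier A" "y \<in> carrier A"
    then show "coordinates F B (j (x \<otimes>\<^bsub>A\<^esub> y)) = coordinates F B (j x) + coordinates F B (j y)"
      by (simp add: coordinates_mult [OF B])
  next
    fix x assume x: "x \<in> carrier A" "coordinates F B (j x) = 0"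
    then have "j x = \<one>\<^bsub>F\<^esub>"
      using coordinates_props [OF B(2), of "j x"] int_combination_zero [OF B(1)] by simp
    then show "x = \<one>\<^bsub>A\<^esub>" using j(2) x(1) by (metis inj_onD j.hom_one one_closed)
  qed
qed

section \<open>Stone spaces of regular open algebras\<close>

text \<open>Stone duality is developed for the regular open algebra of an arbitrary space; the poset
  enters only through its topology.\<close>

definition regular_opens :: "'p topology \<Rightarrow> 'p set gorder" where
  "regular_opens X = \<lparr>carrier = {b. X interior_of (X closure_of b) = b}, eq = (=), le = (\<subseteq>)\<rparr>"

lemma boolean_completion_eq: "boolean_completion P = regular_opens (poset_topology P)"
  by (simp add: boolean_completion_def regular_opens_def)

lemma regular_opens_iff: "b \<in> carrier (regular_opens X) \<longleftrightarrow> X interior_of (X closure_of b) = b"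
  by (simp add: regular_opens_def)

lemma le_regular_opens [simp]: "a \<sqsubseteq>\<^bsub>regular_opens X\<^esub> b \<longleftrightarrow> a \<subseteq> b"
  by (simp add: regular_opens_def)

lemma regular_opens_openin: "b \<in> carrier (regular_opens X) \<Longrightarrow> openin X b"
  unfolding regular_opens_iff by (metis openin_interior_of)

lemma regular_opens_empty: "{} \<in> carrier (regular_opens X)"
  by (simp add: regular_opens_iff)

lemma regular_opens_topspace: "topspace X \<in> carrier (regular_opens X)"
  by (simp add: regular_opens_iff)

lemma regular_opens_Int:
  assumes "a \<in> carrier (regular_opens X)" "b \<in> carrier (regular_opens X)"
  shows "a \<inter> b \<in> carrier (regular_opens X)"
proof -
  have "X interior_of (X closure_of (a \<inter> b)) \<subseteq> X interior_of (X closure_of a)"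
    "X interior_of (X closure_of (a \<inter> b)) \<subseteq> X interior_of (X closure_of b)"
    by (intro interior_of_mono closure_of_mono; simp)+
  then have "X interior_of (X closure_of (a \<inter> b)) \<subseteq> a \<inter> b"
    using assms by (simp add: regular_opens_iff)
  moreover have "openin X (a \<inter> b)"
    using assms by (intro openin_Int regular_opens_openin)
  then have "a \<inter> b \<subseteq> X interior_of (X closure_of (a \<inter> b))"
    by (intro interior_of_maximal closure_of_subset) (auto dest: openin_subset)
  ultimately show ?thesis unfolding regular_opens_iff by (rule subset_antisym)
qed

text \<open>The Boolean complement, which is the largest open set disjoint from a.\<close>

definition ro_compl :: "'p topology \<Rightarrow> 'p set \<Rightarrow> 'p set" where
  "ro_compl X a = topspace X - X closure_of a"

lemma ro_compl_closed:
  assumes "a \<in> carrier (regular_opens X)"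
  shows "ro_compl X a \<in> carrier (regular_opens X)"
  using assms by (simp add: regular_opens_iff ro_compl_def closure_of_complement interior_of_complement)

lemma subset_ro_compl_iff:
  assumes "openin X u"
  shows "u \<subseteq> ro_compl X a \<longleftrightarrow> u \<inter> a = {}"
proof
  assume "u \<subseteq> ro_compl X a"
  moreover have "u \<inter> a \<subseteq> X closure_of a"
    using closure_of_subset_Int [of X a] openin_subset [OF assms] by blast
  ultimately show "u \<inter> a = {}" unfolding ro_compl_def by blast
next
  assume "u \<inter> a = {}"
  then have "u \<inter> X closure_of a = {}" using openin_Int_closure_of_eq_empty [OF assms] by blast
  then show "u \<subseteq> ro_compl X a" unfolding ro_compl_def using openin_subset [OF assms] by blast
qed

lemma ro_compl_disjoint:
  assumes "a \<in> carrier (regular_opens X)"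
  shows "a \<inter> ro_compl X a = {}"
  using subset_ro_compl_iff [OF regular_opens_openin [OF ro_compl_closed [OF assms]], of a] by blast

text \<open>\<open>\<top>\<close>, \<open>\<bottom>\<close> and \<open>\<sqinter>\<close> are
  defined by choice from the order, so each is identified through the uniqueness of greatest and
  least elements.\<close>

lemma top_regular_opens: "\<top>\<^bsub>regular_opens X\<^esub> = topspace X"
proof -
  have sub: "b \<subseteq> topspace X" if "b \<in> carrier (regular_opens X)" for b
    using regular_opens_openin [OF that] by (rule openin_subset)
  show ?thesis
    unfolding top_def greatest_def
    by (rule some_equality) (use regular_opens_topspace sub in \<open>fastforce simp: subset_antisym\<close>)+
qed

lemma bottom_regular_opens: "\<bottom>\<^bsub>regular_opens X\<^esub> = {}"
  unfolding bottom_def least_def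
  by (rule some_equality) (use regular_opens_empty in fastforce)+

lemma meet_regular_opens:
  assumes "a \<in> carrier (regular_opens X)" "b \<in> carrier (regular_opens X)"
  shows "a \<sqinter>\<^bsub>regular_opens X\<^esub> b = a \<inter> b"
proof -
  have L: "Lower (regular_opens X) {a, b} = {l \<in> carrier (regular_opens X). l \<subseteq> a \<inter> b}"
    using assms by (auto simp: Lower_def)
  show ?thesis
    unfolding meet_def inf_def L greatest_def
    by (rule some_equality) (use regular_opens_Int [OF assms] in auto)
qed

section \<open>Filters and ultrafilters of regular open sets\<close>

lemma proper_filter_regular_opens:
  "proper_filter (regular_opens X) U \<longleftrightarrow> U \<subseteq> carrier (regular_opens X) \<and> topspace X \<in> U \<and> {} \<notin> U \<and>
     (\<forall>a\<in>U. \<forall>b\<in>U. a \<inter> b \<in> U) \<and> (\<forall>a\<in>U. \<forall>b\<in>carrier (regular_opens X). a \<subseteq> b \<longrightarrow> b \<in> U)"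
proof (cases "U \<subseteq> carrier (regular_opens X)")
  case True
  then have "a \<sqinter>\<^bsub>regular_opens X\<^esub> b = a \<inter> b" if "a \<in> U" "b \<in> U" for a b
    using that by (intro meet_regular_opens) blast+
  then show ?thesis
    unfolding proper_filter_def top_regular_opens bottom_regular_opens le_regular_opens by simp
qed (simp add: proper_filter_def)

lemma proper_filter_regular_opensI:
  assumes "U \<subseteq> carrier (regular_opens X)" "topspace X \<in> U" "{} \<notin> U"
    and "\<And>a b. a \<in> U \<Longrightarrow> b \<in> U \<Longrightarrow> a \<inter> b \<in> U"
    and "\<And>a b. a \<in> U \<Longrightarrow> b \<in> carrier (regular_opens X) \<Longrightarrow> a \<subseteq> b \<Longrightarrow> b \<in> U"
  shows "proper_filter (regular_opens X) U"
  unfolding proper_filter_regular_opens using assms by simp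

lemma proper_filter_regular_opensD:
  assumes "proper_filter (regular_opens X) U"
  shows "topspace X \<in> U" "{} \<notin> U" "a \<in> U \<Longrightarrow> b \<in> U \<Longrightarrow> a \<inter> b \<in> U"
    "a \<in> U \<Longrightarrow> b \<in> carrier (regular_opens X) \<Longrightarrow> a \<subseteq> b \<Longrightarrow> b \<in> U"
    "a \<in> U \<Longrightarrow> a \<in> carrier (regular_opens X)"
  using assms unfolding proper_filter_regular_opens by blast+

lemma ultrafilter_proper: "ultrafilter L U \<Longrightarrow> proper_filter L U"
  by (simp add: ultrafilter_def)

lemmas ultrafilter_regular_opensD = proper_filter_regular_opensD [OF ultrafilter_proper]

lemma ultrafilter_extends:
  assumes "proper_filter (regular_opens X) V"
  obtains U where "ultrafilter (regular_opens X) U" "V \<subseteq> U"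
proof -
  define \<A> where "\<A> = {U. proper_filter (regular_opens X) U \<and> V \<subseteq> U}"
  have "\<exists>M\<in>\<A>. \<forall>U\<in>\<A>. M \<subseteq> U \<longrightarrow> U = M"
  proof (rule subset_Zorn_nonempty)
    show "\<A> \<noteq> {}" using assms unfolding \<A>_def by blast
  next
    fix \<C> assume \<C>: "\<C> \<noteq> {}" "subset.chain \<A> \<C>"
    then have F: "\<And>U. U \<in> \<C> \<Longrightarrow> proper_filter (regular_opens X) U" "\<And>U. U \<in> \<C> \<Longrightarrow> V \<subseteq> U"
      and chain: "\<And>U W. U \<in> \<C> \<Longrightarrow> W \<in> \<C> \<Longrightarrow> U \<subseteq> W \<or> W \<subseteq> U"
      unfolding subset_chain_def \<A>_def by auto
    note FD = proper_filter_regular_opensD [OF F(1)]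
    have "proper_filter (regular_opens X) (\<Union>\<C>)"
    proof (rule proper_filter_regular_opensI)
      show "\<Union>\<C> \<subseteq> carrier (regular_opens X)" using FD(5) by blast
      show "topspace X \<in> \<Union>\<C>" using \<C>(1) FD(1) by blast
      show "{} \<notin> \<Union>\<C>" using FD(2) by blast
    next
      fix a b assume ab: "a \<in> \<Union>\<C>" "b \<in> \<Union>\<C>"
      then obtain U where "U \<in> \<C>" "a \<in> U" "b \<in> U" using chain by blast
      then show "a \<inter> b \<in> \<Union>\<C>" using FD(3) by blast
    next
      fix a b assume ab: "a \<in> \<Union>\<C>" "b \<in> carrier (regular_opens X)" "a \<subseteq> b"
      then obtain U where "U \<in> \<C>" "a \<in> U" by blast
      then show "b \<in> \<Union>\<C>" using FD(4) ab(2,3) by blast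
    qed
    moreover have "V \<subseteq> \<Union>\<C>" using \<C>(1) F(2) by blast
    ultimately show "\<Union>\<C> \<in> \<A>" unfolding \<A>_def by blast
  qed
  then obtain M where M: "M \<in> \<A>" "\<And>U. U \<in> \<A> \<Longrightarrow> M \<subseteq> U \<Longrightarrow> U = M" by blast
  have "ultrafilter (regular_opens X) M"
    unfolding ultrafilter_def using M unfolding \<A>_def by blast
  moreover have "V \<subseteq> M" using M(1) unfolding \<A>_def by simp
  ultimately show ?thesis by (rule that)
qed

lemma ultrafilter_compl_iff:
  assumes U: "ultrafilter (regular_opens X) U" and b: "b \<in> carrier (regular_opens X)"
  shows "ro_compl X b \<in> U \<longleftrightarrow> b \<notin> U"
proof
  assume "ro_compl X b \<in> U"
  then show "b \<notin> U"
    using ultrafilter_regular_opensD(2,3) [OF U] ro_compl_disjoint [OF b] by metis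
next
  note UD = ultrafilter_regular_opensD [OF U]
  assume nb: "b \<notin> U"
  show "ro_compl X b \<in> U"
  proof (rule ccontr)
    assume nc: "ro_compl X b \<notin> U"
    \<comment> \<open>The filter generated by U and b. It is proper, since u \<inter> b = {} would
      put u below the complement of b, and that complement is not in U.\<close>
    define V where "V = {x \<in> carrier (regular_opens X). \<exists>u\<in>U. u \<inter> b \<subseteq> x}"
    have sub: "U \<subseteq> V" using UD(5) unfolding V_def by blast
    have "proper_filter (regular_opens X) V"
    proof (rule proper_filter_regular_opensI)
      show "{} \<notin> V"
      proof
        assume "{} \<in> V"
        then obtain u where u: "u \<in> U" "u \<inter> b = {}" unfolding V_def by blast
        then have "u \<subseteq> ro_compl X b"
          using subset_ro_compl_iff [OF regular_opens_openin [OF UD(5)]] by blast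
        then show False using u(1) nc UD(4) ro_compl_closed [OF b] by blast
      qed
    next
      fix a c assume ac: "a \<in> V" "c \<in> V"
      then obtain u v where uv: "u \<in> U" "u \<inter> b \<subseteq> a" "v \<in> U" "v \<inter> b \<subseteq> c" unfolding V_def by blast
      have "u \<inter> v \<in> U" "(u \<inter> v) \<inter> b \<subseteq> a \<inter> c" using uv UD(3) by blast+
      then show "a \<inter> c \<in> V" using ac regular_opens_Int unfolding V_def by blast
    next
      show "topspace X \<in> V" using UD(1) sub by blast
    qed (auto simp: V_def)
    with sub U have "V = U" unfolding ultrafilter_def by blast
    moreover have "b \<in> V" unfolding V_def using b UD(1) by blast
    ultimately show False using nb by blast
  qed
qed

section \<open>The Stone topology and its locally constant functions\<close>

lemma topspace_Stone_space: "topspace (Stone_space (regular_opens X)) = {U. ultrafilter (regular_opens X) U}"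
proof -
  have "topspace X \<in> U" if "ultrafilter (regular_opens X) U" for U
    using that by (rule ultrafilter_regular_opensD)
  then show ?thesis unfolding Stone_space_def using regular_opens_topspace [of X] by auto
qed

lemma openin_Stone_space_basic:
  "b \<in> carrier L \<Longrightarrow> openin (Stone_space L) {U. ultrafilter L U \<and> b \<in> U}"
  unfolding Stone_space_def by (rule topology_generated_by_Basis) blast

lemma openin_Stone_spaceD:
  assumes "openin (Stone_space (regular_opens X)) W" "U \<in> W"
  shows "\<exists>b\<in>U. {V. ultrafilter (regular_opens X) V \<and> b \<in> V} \<subseteq> W"
proof -
  define N where "N b = {V. ultrafilter (regular_opens X) V \<and> b \<in> V}" for b
  have "generate_topology_on {N b |b. b \<in> carrier (regular_opens X)} W"
    using assms(1) unfolding Stone_space_def openin_topology_generated_by_iff N_def .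
  moreover have "ultrafilter (regular_opens X) U"
    using openin_subset [OF assms(1)] assms(2) by (auto simp: topspace_Stone_space)
  ultimately have "\<exists>b\<in>U. N b \<subseteq> W"
    using assms(2)
  proof (induction W)
    case (Int W W')
    note UD = ultrafilter_regular_opensD [OF Int.prems(1)]
    obtain b b' where b: "b \<in> U" "N b \<subseteq> W" "b' \<in> U" "N b' \<subseteq> W'"
      using Int by blast
    have "N (b \<inter> b') \<subseteq> N b \<inter> N b'"
      unfolding N_def using ultrafilter_regular_opensD(4) [of X _ "b \<inter> b'"] UD(5) b(1,3) by blast
    with b UD(3) show ?case by blast
  next
    case (UN K)
    then show ?case by blast
  next
    case (Basis s)
    then show ?case unfolding N_def by blast
  qed simp
  then show ?thesis unfolding N_def .
qed

text \<open>Both fibres are basic open sets, the one over 0 belonging to the complement of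
  b.\<close>

lemma continuous_map_Stone_space_of_bool:
  assumes "b \<in> carrier (regular_opens X)"
  shows "continuous_map (Stone_space (regular_opens X)) (discrete_topology UNIV) (\<lambda>U. of_bool (b \<in> U) :: int)"
  unfolding continuous_map_def
proof (intro conjI allI impI)
  fix W :: "int set"
  let ?S = "Stone_space (regular_opens X)"
  define N where "N b = {U. ultrafilter (regular_opens X) U \<and> b \<in> U}" for b
  have "{U \<in> topspace ?S. of_bool (b \<in> U) \<in> W}
      = (if 1 \<in> W then N b else {}) \<union> (if 0 \<in> W then N (ro_compl X b) else {})"
    using ultrafilter_compl_iff [OF _ assms] by (auto simp: topspace_Stone_space N_def)
  moreover have "openin ?S (N b)" "openin ?S (N (ro_compl X b))"
    unfolding N_def by (intro openin_Stone_space_basic assms ro_compl_closed)+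
  ultimately show "openin ?S {U \<in> topspace ?S. of_bool (b \<in> U) \<in> W}"
    by (simp add: openin_Un)
qed simp

text \<open>If a locally constant function factors through no finite set of coordinates, then the regular
  open sets whose complement it factors on form a proper filter; at an ultrafilter
  extending it the function cannot be locally constant.\<close>

lemma continuous_map_Stone_space_depends_on:
  assumes h: "continuous_map (Stone_space (regular_opens X)) (discrete_topology UNIV) h"
  obtains f where "depends_on f UNIV" "\<And>U. ultrafilter (regular_opens X) U \<Longrightarrow> f U = h U"
proof -
  let ?R = "carrier (regular_opens X)" and ?u = "ultrafilter (regular_opens X)"
  define factors where "factors x \<longleftrightarrow>
    (\<exists>G. finite G \<and> (\<forall>U V. ?u U \<longrightarrow> ?u V \<longrightarrow> x \<notin> U \<longrightarrow> x \<notin> V \<longrightarrow> U \<inter> G = V \<inter> G \<longrightarrow> h U = h V))" for x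
  note u = ultrafilter_regular_opensD [of X]
  have factorsI: "factors x" if "finite G"
      "\<And>U V. ?u U \<Longrightarrow> ?u V \<Longrightarrow> x \<notin> U \<Longrightarrow> x \<notin> V \<Longrightarrow> U \<inter> G = V \<inter> G \<Longrightarrow> h U = h V" for x G
    unfolding factors_def
  proof (intro exI conjI allI impI)
    fix U V assume "?u U" "?u V" "x \<notin> U" "x \<notin> V" "U \<inter> G = V \<inter> G"
    then show "h U = h V" by (rule that(2))
  qed (fact that(1))
  have factorsE: "\<exists>G. finite G \<and> (\<forall>U V. ?u U \<longrightarrow> ?u V \<longrightarrow> x \<notin> U \<longrightarrow> x \<notin> V \<longrightarrow> U \<inter> G = V \<inter> G \<longrightarrow> h U = h V)"
    if "factors x" for x
    using that unfolding factors_def .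
  have "factors {}"
  proof (rule ccontr)
    assume nf: "\<not> factors {}"
    define V where "V = {x \<in> ?R. factors x}"
    have "proper_filter (regular_opens X) V"
    proof (rule proper_filter_regular_opensI)
      have "factors (topspace X)" by (rule factorsI [of "{}"]) (use u(1) in blast)+
      then show "topspace X \<in> V" unfolding V_def using regular_opens_topspace by blast
    next
      fix x y assume xy: "x \<in> V" "y \<in> V"
      then have "factors x" "factors y" unfolding V_def by blast+
      then obtain G G' where G: "finite G" "\<And>U V. ?u U \<Longrightarrow> ?u V \<Longrightarrow> x \<notin> U \<Longrightarrow> x \<notin> V \<Longrightarrow> U \<inter> G = V \<inter> G \<Longrightarrow> h U = h V"
        and G': "finite G'" "\<And>U V. ?u U \<Longrightarrow> ?u V \<Longrightarrow> y \<notin> U \<Longrightarrow> y \<notin> V \<Longrightarrow> U \<inter> G' = V \<inter> G' \<Longrightarrow> h U = h V"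
        using factorsE by metis
      have "factors (x \<inter> y)"
      proof (rule factorsI)
        \<comment> \<open>With x and y themselves among the coordinates, U and V omit the same one
          of the two, so one of the given factorizations applies to both.\<close>
        show "finite (insert x (insert y (G \<union> G')))" using G(1) G'(1) by simp
      next
        fix U V assume UV: "?u U" "?u V" "x \<inter> y \<notin> U" "x \<inter> y \<notin> V"
          "U \<inter> insert x (insert y (G \<union> G')) = V \<inter> insert x (insert y (G \<union> G'))"
        have eq: "U \<inter> G = V \<inter> G" "U \<inter> G' = V \<inter> G'" "x \<in> U \<longleftrightarrow> x \<in> V" "y \<in> U \<longleftrightarrow> y \<in> V"
          using UV(5) by blast+
        show "h U = h V"
        proof (cases "x \<in> U")
          case True
          then have "y \<notin> U" using u(3) [OF UV(1)] UV(3) by blast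
          then show ?thesis using G'(2) [OF UV(1,2)] eq by simp
        next
          case False
          then show ?thesis using G(2) [OF UV(1,2)] eq by simp
        qed
      qed
      then show "x \<inter> y \<in> V" using xy regular_opens_Int unfolding V_def by blast
    next
      fix x y assume xy: "x \<in> V" "y \<in> ?R" "x \<subseteq> y"
      then have "factors x" unfolding V_def by blast
      then obtain G where G: "finite G" "\<And>U V. ?u U \<Longrightarrow> ?u V \<Longrightarrow> x \<notin> U \<Longrightarrow> x \<notin> V \<Longrightarrow> U \<inter> G = V \<inter> G \<Longrightarrow> h U = h V"
        using factorsE by meson
      have "x \<notin> U" if "?u U" "y \<notin> U" for U using u(4) [OF that(1) _ xy(2,3)] that(2) by blast
      then have "factors y" by (intro factorsI [OF G(1)] G(2))
      then show "y \<in> V" using xy(2) unfolding V_def by blast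
    qed (use nf in \<open>auto simp: V_def\<close>)
    then obtain U where U: "?u U" "V \<subseteq> U" by (rule ultrafilter_extends)
    let ?W = "{V \<in> topspace (Stone_space (regular_opens X)). h V \<in> {h U}}"
    have "openin (Stone_space (regular_opens X)) ?W"
      using h by (rule openin_continuous_map_preimage) simp
    moreover have "U \<in> ?W" using U(1) by (simp add: topspace_Stone_space)
    ultimately obtain b where b: "b \<in> U" "{V. ?u V \<and> b \<in> V} \<subseteq> ?W"
      using openin_Stone_spaceD by blast
    have bR: "b \<in> ?R" using u(5) [OF U(1) b(1)] .
    \<comment> \<open>The ultrafilters omitting the complement of b are those containing b, where h
      is constant. So the complement factors h with no coordinates at all and lies in U together
      with b.\<close>
    have "h V = h U" if "?u V" "ro_compl X b \<notin> V" for V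
      using that b(2) ultrafilter_compl_iff [OF that(1) bR] by blast
    then have "factors (ro_compl X b)" by (intro factorsI [of "{}"]) simp_all
    then have "ro_compl X b \<in> U" using U(2) ro_compl_closed [OF bR] unfolding V_def by blast
    then show False using ultrafilter_compl_iff [OF U(1) bR] b(1) by blast
  qed
  obtain G where G: "finite G" "\<And>U V. ?u U \<Longrightarrow> ?u V \<Longrightarrow> U \<inter> G = V \<inter> G \<Longrightarrow> h U = h V"
    using factorsE [OF \<open>factors {}\<close>] u(2) by meson
  \<comment> \<open>Only the values of h at ultrafilters are controlled, but f must factor on the
    whole cube: it evaluates h at a chosen ultrafilter with the same trace on G, and at an arbitrary
    set if there is none.\<close>
  define f where "f x = h (SOME V. ?u V \<and> V \<inter> G = x \<inter> G)" for x
  have "depends_on f UNIV"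
    by (rule depends_onI [OF G(1)]) (simp_all add: f_def Int_assoc)
  moreover have "f U = h U" if "?u U" for U
  proof -
    have "?u (SOME V. ?u V \<and> V \<inter> G = U \<inter> G) \<and> (SOME V. ?u V \<and> V \<inter> G = U \<inter> G) \<inter> G = U \<inter> G"
      by (rule someI [of _ U]) (use that in simp)
    then show ?thesis unfolding f_def using G(2) that by blast
  qed
  ultimately show ?thesis using that by blast
qed

section \<open>The Cohen poset\<close>

text \<open>The Boolean value of the statement that the generic function takes the value 1 at
  \<alpha>.\<close>

definition cohen :: "'k rel \<Rightarrow> 'k \<Rightarrow> ('k \<rightharpoonup> bool) set" where
  "cohen \<kappa> \<alpha> = {p \<in> carrier (Add_omega \<kappa>). p \<alpha> = Some True}"

abbreviation cohen_topology :: "'k rel \<Rightarrow> ('k \<rightharpoonup> bool) topology" where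
  "cohen_topology \<kappa> \<equiv> poset_topology (Add_omega \<kappa>)"

lemma carrier_Add_omega [simp]: "p \<in> carrier (Add_omega \<kappa>) \<longleftrightarrow> finite (dom p) \<and> dom p \<subseteq> Field \<kappa>"
  by (simp add: Add_omega_def)

lemma le_Add_omega [simp]: "p \<sqsubseteq>\<^bsub>Add_omega \<kappa>\<^esub> q \<longleftrightarrow> q \<subseteq>\<^sub>m p"
  by (simp add: Add_omega_def)

lemma openin_cohen_cone:
  "p \<in> carrier (Add_omega \<kappa>) \<Longrightarrow> openin (cohen_topology \<kappa>) {q \<in> carrier (Add_omega \<kappa>). p \<subseteq>\<^sub>m q}"
  unfolding poset_topology_def le_Add_omega by (rule topology_generated_by_Basis) blast

lemma topspace_cohen: "topspace (cohen_topology \<kappa>) = carrier (Add_omega \<kappa>)"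
  unfolding poset_topology_def topology_generated_by_topspace le_Add_omega
proof (intro subset_antisym subsetI)
  fix p assume "p \<in> carrier (Add_omega \<kappa>)"
  then show "p \<in> \<Union> {{q \<in> carrier (Add_omega \<kappa>). p \<subseteq>\<^sub>m q} |p. p \<in> carrier (Add_omega \<kappa>)}"
    by (intro UnionI [of "{q \<in> carrier (Add_omega \<kappa>). p \<subseteq>\<^sub>m q}"]) (use map_le_refl in blast)+
qed blast

lemma openin_cohenD:
  assumes "openin (cohen_topology \<kappa>) b" "p \<in> b" "q \<in> carrier (Add_omega \<kappa>)" "p \<subseteq>\<^sub>m q"
  shows "q \<in> b"
proof -
  have "generate_topology_on {{q \<in> carrier (Add_omega \<kappa>). p \<subseteq>\<^sub>m q} | p. p \<in> carrier (Add_omega \<kappa>)} b"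
    using assms(1) unfolding poset_topology_def openin_topology_generated_by_iff le_Add_omega .
  then show ?thesis
    using assms(2)
  proof (induction b)
    case (Basis s)
    then obtain r where "s = {q \<in> carrier (Add_omega \<kappa>). r \<subseteq>\<^sub>m q}" by blast
    then show ?case using Basis(2) assms(3) map_le_trans [OF _ assms(4)] by simp
  qed auto
qed

text \<open>A condition p outside the set either gives \<alpha> the value 0 or leaves it open. Then
  p(\<alpha> \<mapsto> False) extends p, and the cone of this extension misses the set, so p is not
  interior to the closure.\<close>

lemma cohen_regular_open: "cohen \<kappa> \<alpha> \<in> carrier (regular_opens (cohen_topology \<kappa>))"
proof -
  let ?X = "cohen_topology \<kappa>" and ?C = "carrier (Add_omega \<kappa>)"
  have "cohen \<kappa> \<alpha> = (\<Union>p\<in>cohen \<kappa> \<alpha>. {q \<in> ?C. p \<subseteq>\<^sub>m q})"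
  proof (intro subset_antisym subsetI)
    fix q assume "q \<in> (\<Union>p\<in>cohen \<kappa> \<alpha>. {q \<in> ?C. p \<subseteq>\<^sub>m q})"
    then obtain p where p: "p \<in> cohen \<kappa> \<alpha>" "q \<in> ?C" "p \<subseteq>\<^sub>m q" by blast
    then have "p \<alpha> = Some True" by (simp add: cohen_def)
    then have "q \<alpha> = Some True" using p(3) unfolding map_le_def by (metis domI)
    with p(2) show "q \<in> cohen \<kappa> \<alpha>" by (simp add: cohen_def)
  next
    fix q assume "q \<in> cohen \<kappa> \<alpha>"
    then show "q \<in> (\<Union>p\<in>cohen \<kappa> \<alpha>. {q \<in> ?C. p \<subseteq>\<^sub>m q})"
      by (intro UN_I [of q]) (simp_all add: cohen_def)
  qed
  moreover have "openin ?X (\<Union>p\<in>cohen \<kappa> \<alpha>. {q \<in> ?C. p \<subseteq>\<^sub>m q})"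
    by (intro openin_Union) (use openin_cohen_cone in \<open>auto simp: cohen_def\<close>)
  ultimately have op: "openin ?X (cohen \<kappa> \<alpha>)" by simp
  have "p \<in> cohen \<kappa> \<alpha>" if p: "p \<in> ?X interior_of (?X closure_of cohen \<kappa> \<alpha>)" for p
  proof (rule ccontr)
    assume np: "p \<notin> cohen \<kappa> \<alpha>"
    have pC: "p \<in> ?C"
      using p interior_of_subset_topspace [of ?X] unfolding topspace_cohen by blast
    \<comment> \<open>For \<alpha> outside \<open>Field \<kappa>\<close> the set is empty; here p
      witnesses that it is not, so \<alpha> may be added to the domain of p.\<close>
    have "cohen \<kappa> \<alpha> \<noteq> {}" using p by auto
    then have "\<alpha> \<in> Field \<kappa>" by (auto simp: cohen_def)
    with pC have q: "p(\<alpha> \<mapsto> False) \<in> ?C" by simp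
    have "p \<alpha> = None \<or> p \<alpha> = Some False" using np pC by (cases "p \<alpha>") (auto simp: cohen_def)
    then have "p \<subseteq>\<^sub>m p(\<alpha> \<mapsto> False)" by (auto simp: map_le_def)
    then have "p(\<alpha> \<mapsto> False) \<in> ?X interior_of (?X closure_of cohen \<kappa> \<alpha>)"
      using openin_cohenD [OF openin_interior_of p q] by blast
    then have 1: "p(\<alpha> \<mapsto> False) \<in> ?X closure_of cohen \<kappa> \<alpha>"
      by (rule subsetD [OF interior_of_subset])
    have "r \<notin> cohen \<kappa> \<alpha>" if "p(\<alpha> \<mapsto> False) \<subseteq>\<^sub>m r" for r
    proof -
      have "r \<alpha> = Some False" using that by (auto simp: map_le_def)
      then show ?thesis by (simp add: cohen_def)
    qed
    then have "{r \<in> ?C. p(\<alpha> \<mapsto> False) \<subseteq>\<^sub>m r} \<inter> cohen \<kappa> \<alpha> = {}" by blast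
    then have 2: "{r \<in> ?C. p(\<alpha> \<mapsto> False) \<subseteq>\<^sub>m r} \<inter> ?X closure_of cohen \<kappa> \<alpha> = {}"
      by (simp only: openin_Int_closure_of_eq_empty [OF openin_cohen_cone [OF q]])
    have "p(\<alpha> \<mapsto> False) \<in> {r \<in> ?C. p(\<alpha> \<mapsto> False) \<subseteq>\<^sub>m r}"
      using q by simp
    then have "p(\<alpha> \<mapsto> False) \<in> {r \<in> ?C. p(\<alpha> \<mapsto> False) \<subseteq>\<^sub>m r} \<inter> ?X closure_of cohen \<kappa> \<alpha>"
      by (rule IntI [OF _ 1])
    then show False unfolding 2 by (rule emptyE)
  qed
  then have "?X interior_of (?X closure_of cohen \<kappa> \<alpha>) \<subseteq> cohen \<kappa> \<alpha>" by (rule subsetI)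
  moreover have "cohen \<kappa> \<alpha> \<subseteq> ?X closure_of cohen \<kappa> \<alpha>"
    by (rule closure_of_subset [OF openin_subset [OF op]])
  then have "cohen \<kappa> \<alpha> \<subseteq> ?X interior_of (?X closure_of cohen \<kappa> \<alpha>)"
    by (rule interior_of_maximal [OF _ op])
  ultimately show ?thesis unfolding regular_opens_iff by (rule subset_antisym)
qed

lemma inj_on_cohen: "inj_on (cohen \<kappa>) (Field \<kappa>)"
proof (rule inj_onI)
  fix \<alpha> \<beta> assume \<alpha>: "\<alpha> \<in> Field \<kappa>" and eq: "cohen \<kappa> \<alpha> = cohen \<kappa> \<beta>"
  have "[\<alpha> \<mapsto> True] \<in> cohen \<kappa> \<alpha>" using \<alpha> by (simp add: cohen_def)
  then have "[\<alpha> \<mapsto> True] \<beta> = Some True" unfolding eq by (simp add: cohen_def)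
  then show "\<alpha> = \<beta>" by (simp split: if_splits)
qed

text \<open>A finite pattern of Cohen coordinates is itself a condition p, and an ultrafilter
  concentrating on p realizes the pattern.\<close>

lemma cohen_independent:
  assumes G: "finite G" "G \<subseteq> cohen \<kappa> ` Field \<kappa>" and H: "H \<subseteq> G"
  shows "\<exists>U\<in>topspace (Stone_space (regular_opens (cohen_topology \<kappa>))). U \<inter> G = H"
proof -
  let ?X = "cohen_topology \<kappa>" and ?C = "carrier (Add_omega \<kappa>)"
  obtain D where D: "D \<subseteq> Field \<kappa>" "finite D" "G = cohen \<kappa> ` D"
    using finite_subset_image [OF G] by blast
  define p where "p \<alpha> = (if \<alpha> \<in> D then Some (cohen \<kappa> \<alpha> \<in> H) else None)" for \<alpha>
  have "dom p = D" by (auto simp: p_def dom_def)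
  with D have p: "p \<in> ?C" by simp
  \<comment> \<open>Membership of the point p is preserved by intersections and supersets, so V is a
    proper filter. It contains each b in H, and for the other b in G the complement, because the
    cone of p misses b.\<close>
  define V where "V = {b \<in> carrier (regular_opens ?X). p \<in> b}"
  have "proper_filter (regular_opens ?X) V"
  proof (rule proper_filter_regular_opensI)
    show "topspace ?X \<in> V"
      using regular_opens_topspace [of ?X] p unfolding V_def topspace_cohen by blast
  qed (use regular_opens_Int in \<open>auto simp: V_def\<close>)
  then obtain U where U: "ultrafilter (regular_opens ?X) U" "V \<subseteq> U" by (rule ultrafilter_extends)
  have "b \<in> U \<longleftrightarrow> b \<in> H" if b: "b \<in> G" for b
  proof -
    obtain \<alpha> where \<alpha>: "\<alpha> \<in> D" "b = cohen \<kappa> \<alpha>" using b D(3) by blast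
    then have p\<alpha>: "p \<alpha> = Some (b \<in> H)" by (simp add: p_def)
    have bR: "b \<in> carrier (regular_opens ?X)" unfolding \<alpha>(2) by (rule cohen_regular_open)
    show ?thesis
    proof (cases "b \<in> H")
      case True
      then have "p \<in> b" using p\<alpha> p \<alpha>(2) unfolding cohen_def by simp
      then show ?thesis using True U(2) bR unfolding V_def by blast
    next
      case False
      have "r \<alpha> = Some False" if "p \<subseteq>\<^sub>m r" for r
        using that p\<alpha> False by (force simp: map_le_def)
      then have "{q \<in> ?C. p \<subseteq>\<^sub>m q} \<inter> b = {}" unfolding \<alpha>(2) by (fastforce simp: cohen_def)
      then have "{q \<in> ?C. p \<subseteq>\<^sub>m q} \<subseteq> ro_compl ?X b"
        using subset_ro_compl_iff [OF openin_cohen_cone [OF p]] by blast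
      then have "p \<in> ro_compl ?X b" using p map_le_refl by blast
      then have "ro_compl ?X b \<in> U" using U(2) ro_compl_closed [OF bR] unfolding V_def by blast
      then show ?thesis using False ultrafilter_compl_iff [OF U(1) bR] by blast
    qed
  qed
  then have "U \<inter> G = H" using H by blast
  then show ?thesis using U(1) unfolding topspace_Stone_space by blast
qed

section \<open>Continuous maps into groups of homomorphisms\<close>

lemma continuous_map_Hom_int:
  "continuous_map S (Hom_int G) \<phi> \<longleftrightarrow>
     (\<forall>U\<in>topspace S. \<phi> U \<in> extensional (carrier G) \<and> \<phi> U \<in> hom G integer_group) \<and>
     (\<forall>x\<in>carrier G. continuous_map S (discrete_topology UNIV) (\<lambda>U. \<phi> U x))"
  unfolding Hom_int_def continuous_map_in_subtopology continuous_map_componentwise by blast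

text \<open>A product of two discrete spaces is discrete, which makes every h continuous.\<close>

lemma continuous_map_discrete_combine:
  assumes "continuous_map S (discrete_topology UNIV) f" "continuous_map S (discrete_topology UNIV) g"
  shows "continuous_map S (discrete_topology UNIV) (\<lambda>x. h (f x) (g x))"
proof -
  have "continuous_map S (discrete_topology UNIV) (\<lambda>x. (f x, g x))"
    using continuous_map_pairedI [OF assms] by (simp flip: prod_topology_discrete_topology)
  then have "continuous_map S (discrete_topology UNIV) ((\<lambda>(a, b). h a b) \<circ> (\<lambda>x. (f x, g x)))"
    by (rule continuous_map_compose) (simp add: continuous_map_def)
  then show ?thesis by (simp add: o_def)
qed

lemma continuous_map_discrete_sum:
  fixes f :: "'a \<Rightarrow> 'b \<Rightarrow> int"
  assumes "finite A" "\<And>a. a \<in> A \<Longrightarrow> continuous_map S (discrete_topology UNIV) (f a)"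
  shows "continuous_map S (discrete_topology UNIV) (\<lambda>x. \<Sum>a\<in>A. f a x)"
  using assms
proof (induction A rule: finite_induct)
  case (insert a A)
  then have "continuous_map S (discrete_topology UNIV) (\<lambda>x. f a x + (\<Sum>a\<in>A. f a x))"
    using continuous_map_discrete_combine [where h = "(+)"] by blast
  with insert show ?case by simp
qed simp

section \<open>Extending families of values linearly from a basis\<close>

definition linear_extension :: "('a, 'm) monoid_scheme \<Rightarrow> 'a set \<Rightarrow> ('a \<Rightarrow> int) \<Rightarrow> 'a \<Rightarrow> int" where
  "linear_extension G B v = (\<lambda>k\<in>carrier G.
     \<Sum>t\<in>Poly_Mapping.keys (coordinates G B k). Poly_Mapping.lookup (coordinates G B k) t * v t)"

lemma linear_extension_extensional: "linear_extension G B v \<in> extensional (carrier G)"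
  by (simp add: linear_extension_def)

lemma sum_keys_add:
  fixes v :: "'a \<Rightarrow> int"
  shows "(\<Sum>t\<in>Poly_Mapping.keys (c + d). Poly_Mapping.lookup (c + d) t * v t)
     = (\<Sum>t\<in>Poly_Mapping.keys c. Poly_Mapping.lookup c t * v t)
     + (\<Sum>t\<in>Poly_Mapping.keys d. Poly_Mapping.lookup d t * v t)"
proof -
  let ?A = "Poly_Mapping.keys c \<union> Poly_Mapping.keys d"
  have sup: "(\<Sum>t\<in>Poly_Mapping.keys e. Poly_Mapping.lookup e t * v t) = (\<Sum>t\<in>?A. Poly_Mapping.lookup e t * v t)"
    if "Poly_Mapping.keys e \<subseteq> ?A" for e
    by (rule sum.mono_neutral_left) (use that in \<open>auto simp: in_keys_iff\<close>)
  show ?thesis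
    unfolding sup [OF keys_add] sup [OF Un_upper1] sup [OF Un_upper2]
    by (simp add: lookup_add distrib_right sum.distrib)
qed

lemma linear_extension_hom:
  assumes "comm_group G" "is_basis G B"
  shows "linear_extension G B v \<in> hom G integer_group"
proof -
  interpret comm_group G by fact
  show ?thesis
    by (rule homI) (simp_all add: linear_extension_def coordinates_mult [OF assms] sum_keys_add)
qed

lemma linear_extension_basis:
  assumes "comm_group G" "is_basis G B" "t \<in> B"
  shows "linear_extension G B v t = v t"
proof -
  have "t \<in> carrier G" using assms(2,3) by (auto simp: is_basis_def)
  then show ?thesis by (simp add: linear_extension_def coordinates_basis [OF assms])
qed

text \<open>Continuity into \<open>Hom_int\<close> is tested at each k separately, and k has only
  finitely many nonzero coordinates.\<close>

lemma continuous_map_linear_extension: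
  assumes G: "comm_group G" "is_basis G B"
    and v: "\<And>t. t \<in> B \<Longrightarrow> continuous_map S (discrete_topology UNIV) (\<lambda>U. v U t)"
  shows "continuous_map S (Hom_int G) (\<lambda>U. linear_extension G B (v U))"
  unfolding continuous_map_Hom_int
proof (intro conjI ballI)
  fix k assume k: "k \<in> carrier G"
  let ?c = "coordinates G B k"
  have "continuous_map S (discrete_topology UNIV)
      (\<lambda>U. \<Sum>t\<in>Poly_Mapping.keys ?c. Poly_Mapping.lookup ?c t * v U t)"
  proof (rule continuous_map_discrete_sum)
    fix t assume "t \<in> Poly_Mapping.keys ?c"
    then have "t \<in> B" using coordinates_props [OF G(2) k] by blast
    from continuous_map_discrete_combine [OF v [OF this] v [OF this], of "\<lambda>a _. Poly_Mapping.lookup ?c t * a"]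
    show "continuous_map S (discrete_topology UNIV) (\<lambda>U. Poly_Mapping.lookup ?c t * v U t)" .
  qed simp
  then show "continuous_map S (discrete_topology UNIV) (\<lambda>U. linear_extension G B (v U) k)"
    using k by (simp add: linear_extension_def)
qed (simp_all add: linear_extension_hom [OF G] linear_extension_extensional)

section \<open>Splitting the extension\<close>

text \<open>The functionals \<open>\<rho> _ t\<close> define a retraction of \<open>F\<close> onto the subgroup generated by \<open>T\<close>.
  Since all relations between the representatives \<open>s a\<close> lie in that subgroup, the complementary
  projection makes \<open>s\<close> a homomorphism.\<close>

lemma is_free_abelian_of_dual_functionals:
  fixes A :: "('a, 'm) monoid_scheme" and F :: "('f, 'n) monoid_scheme"
    and K :: "'f set" and \<pi> :: "'f \<Rightarrow> 'a" and \<rho> :: "'f \<Rightarrow> 'f \<Rightarrow> int"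
  defines "G \<equiv> F\<lparr>carrier := K\<rparr>"
  assumes A: "comm_group A" and F: "is_free_abelian F" and K: "subgroup K F" and G: "comm_group G"
    and \<pi>: "\<pi> \<in> hom F A" "kernel F A \<pi> = K"
    and B: "is_basis G B" and T: "T \<subseteq> B"
    and s: "\<And>a. a \<in> carrier A \<Longrightarrow> s a \<in> carrier F \<and> \<pi> (s a) = a"
    and rel: "\<And>a b. a \<in> carrier A \<Longrightarrow> b \<in> carrier A \<Longrightarrow>
      Poly_Mapping.keys (coordinates G B (s a \<otimes>\<^bsub>F\<^esub> s b \<otimes>\<^bsub>F\<^esub> inv\<^bsub>F\<^esub> s (a \<otimes>\<^bsub>A\<^esub> b))) \<subseteq> T"
    and \<rho>_fin: "\<And>x. x \<in> carrier F \<Longrightarrow> finite {t \<in> T. \<rho> x t \<noteq> 0}"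
    and \<rho>_add: "\<And>x y t. x \<in> carrier F \<Longrightarrow> y \<in> carrier F \<Longrightarrow> t \<in> T \<Longrightarrow> \<rho> (x \<otimes>\<^bsub>F\<^esub> y) t = \<rho> x t + \<rho> y t"
    and \<rho>_basis: "\<And>t u. t \<in> T \<Longrightarrow> u \<in> T \<Longrightarrow> \<rho> t u = of_bool (t = u)"
  shows "is_free_abelian A"
proof -
  interpret A: comm_group A by fact
  interpret F: comm_group F using F by (simp add: is_free_abelian_def)
  interpret \<pi>: group_hom F A \<pi> by (intro group_hom.intro group_hom_axioms.intro \<pi>) auto
  interpret K: subgroup K F by fact
  interpret G: comm_group G by fact
  have G_simps [simp]: "carrier G = K" "x \<otimes>\<^bsub>G\<^esub> y = x \<otimes>\<^bsub>F\<^esub> y" "\<one>\<^bsub>G\<^esub> = \<one>\<^bsub>F\<^esub>" for x y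
    by (simp_all add: G_def)
  have BK: "B \<subseteq> K" using B by (simp add: is_basis_def)
  have KF: "x \<in> carrier F" if "x \<in> K" for x using that K.subset by blast
  have \<pi>K: "\<pi> x = \<one>\<^bsub>A\<^esub> \<longleftrightarrow> x \<in> K" if "x \<in> carrier F" for x
    using \<pi>(2) that by (auto simp: kernel_def)
  \<comment> \<open>Finite support is what lets the values \<open>\<rho> x t\<close> be collected
    into one integer combination; they are cut to 0 outside T, where \<rho> is uncontrolled.\<close>
  define c where "c x = Poly_Mapping.Abs_poly_mapping (\<lambda>t. if t \<in> T then \<rho> x t else 0)" for x
  have lookup_c: "Poly_Mapping.lookup (c x) t = (if t \<in> T then \<rho> x t else 0)" if "x \<in> carrier F" for x t
  proof -
    have "{t. (if t \<in> T then \<rho> x t else 0) \<noteq> 0} = {t \<in> T. \<rho> x t \<noteq> 0}" by auto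
    with \<rho>_fin [OF that] show ?thesis unfolding c_def by (subst lookup_Abs_poly_mapping) simp_all
  qed
  have keys_c: "Poly_Mapping.keys (c x) \<subseteq> T" if "x \<in> carrier F" for x
    using lookup_c [OF that] by (auto simp: in_keys_iff split: if_splits)
  have c_add: "c (x \<otimes>\<^bsub>F\<^esub> y) = c x + c y" if "x \<in> carrier F" "y \<in> carrier F" for x y
    using that by (intro poly_mapping_eqI) (simp add: lookup_c lookup_add \<rho>_add)
  \<comment> \<open>For t in T, \<rho> at t is additive and agrees on T with the t-th coordinate
    function, hence on everything T generates.\<close>
  have c_K: "c x = coordinates G B x"
    if x: "x \<in> K" "Poly_Mapping.keys (coordinates G B x) \<subseteq> T" for x
  proof (rule poly_mapping_eqI)
    fix t
    let ?d = "coordinates G B x"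
    have "int_combination G ?d = x" using coordinates_props [OF B, of x] x by simp
    show "Poly_Mapping.lookup (c x) t = Poly_Mapping.lookup ?d t"
    proof (cases "t \<in> T")
      case True
      have "(\<lambda>y. \<rho> y t) \<in> hom G integer_group"
        using \<rho>_add [OF _ _ True] KF by (intro homI) simp_all
      then have "\<rho> (int_combination G ?d) t
          = (\<Sum>b\<in>Poly_Mapping.keys ?d. Poly_Mapping.lookup ?d b * \<rho> b t)"
        using hom_int_combination [OF G] x(2) T BK by (metis G_simps(1) order_trans)
      also have "\<dots> = (\<Sum>b\<in>Poly_Mapping.keys ?d. if b = t then Poly_Mapping.lookup ?d b else 0)"
        by (rule sum.cong) (use x(2) \<rho>_basis True in auto)
      also have "\<dots> = Poly_Mapping.lookup ?d t"
        by (simp add: sum.delta in_keys_iff)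
      finally show ?thesis using True lookup_c [OF KF [OF x(1)]] \<open>int_combination G ?d = x\<close> by simp
    next
      case False
      then show ?thesis using x(2) lookup_c [OF KF [OF x(1)]] by (auto simp: in_keys_iff)
    qed
  qed
  define q where "q x = int_combination G (c x)" for x
  have keys_cK: "Poly_Mapping.keys (c x) \<subseteq> carrier G" if "x \<in> carrier F" for x
    using keys_c [OF that] T BK by simp
  have qK: "q x \<in> K" if "x \<in> carrier F" for x
    using int_combination_closed [OF G keys_cK [OF that]] by (simp add: q_def)
  have q_mult: "q (x \<otimes>\<^bsub>F\<^esub> y) = q x \<otimes>\<^bsub>F\<^esub> q y" if "x \<in> carrier F" "y \<in> carrier F" for x y
    using int_combination_add [OF G keys_cK [OF that(1)] keys_cK [OF that(2)]]
    by (simp add: q_def c_add [OF that])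
  define \<theta> where "\<theta> x = x \<otimes>\<^bsub>F\<^esub> inv\<^bsub>F\<^esub> q x" for x
  have \<theta>F: "\<theta> x \<in> carrier F" if "x \<in> carrier F" for x
    using that qK KF by (simp add: \<theta>_def)
  have \<theta>_mult: "\<theta> (x \<otimes>\<^bsub>F\<^esub> y) = \<theta> x \<otimes>\<^bsub>F\<^esub> \<theta> y" if "x \<in> carrier F" "y \<in> carrier F" for x y
    using that qK KF by (simp add: \<theta>_def q_mult F.inv_mult F.m_ac)
  \<comment> \<open>\<open>j a\<close> differs from \<open>s a\<close> by an element of K, so
    \<open>\<pi>\<close> still maps it to a. This yields injectivity.\<close>
  define j where "j a = \<theta> (s a)" for a
  have \<pi>j: "\<pi> (j a) = a" if a: "a \<in> carrier A" for a
  proof -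
    have "\<pi> (q (s a)) = \<one>\<^bsub>A\<^esub>" using \<pi>K qK KF s [OF a] by blast
    then show ?thesis using a s [OF a] qK [of "s a"] KF by (simp add: j_def \<theta>_def)
  qed
  have "j \<in> hom A F"
  proof (rule homI)
    fix a assume "a \<in> carrier A"
    then show "j a \<in> carrier F" using s \<theta>F by (simp add: j_def)
  next
    fix a b assume ab: "a \<in> carrier A" "b \<in> carrier A"
    let ?r = "s a \<otimes>\<^bsub>F\<^esub> s b \<otimes>\<^bsub>F\<^esub> inv\<^bsub>F\<^esub> s (a \<otimes>\<^bsub>A\<^esub> b)"
    have sF: "s a \<in> carrier F" "s b \<in> carrier F" "s (a \<otimes>\<^bsub>A\<^esub> b) \<in> carrier F" using s ab by simp_all
    have "\<pi> ?r = \<one>\<^bsub>A\<^esub>" using s ab sF by simp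
    then have rK: "?r \<in> K" using \<pi>K [of ?r] sF by simp
    have "q ?r = ?r"
      using c_K [OF rK rel [OF ab]] coordinates_props [OF B, of ?r] rK by (simp add: q_def)
    then have "\<theta> ?r = \<one>\<^bsub>F\<^esub>" using sF by (simp add: \<theta>_def)
    moreover have "?r \<otimes>\<^bsub>F\<^esub> s (a \<otimes>\<^bsub>A\<^esub> b) = s a \<otimes>\<^bsub>F\<^esub> s b" using sF by (simp add: F.m_assoc)
    ultimately have "\<theta> (s a \<otimes>\<^bsub>F\<^esub> s b) = \<theta> (s (a \<otimes>\<^bsub>A\<^esub> b))"
      using \<theta>_mult [of ?r "s (a \<otimes>\<^bsub>A\<^esub> b)"] sF \<theta>F by simp
    then show "j (a \<otimes>\<^bsub>A\<^esub> b) = j a \<otimes>\<^bsub>F\<^esub> j b" using \<theta>_mult sF by (simp add: j_def)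
  qed
  moreover have "inj_on j (carrier A)" by (rule inj_on_inverseI [of _ \<pi>]) (rule \<pi>j)
  ultimately show ?thesis by (rule is_free_abelian_of_injective_hom [OF A F])
qed

text \<open>Each x in F gives the locally constant function sending U to \<open>\<psi> U x\<close>.
  Applying to it the functional dual to \<open>cohen \<kappa> (e t)\<close> defines
  \<open>\<rho> x t\<close>: additive because each \<open>\<psi> U\<close> is a homomorphism, and
  dual on T by \<open>lift\<close>.\<close>

lemma is_free_abelian_of_lift:
  fixes A :: "('a, 'm) monoid_scheme" and F :: "('f, 'n) monoid_scheme"
    and K :: "'f set" and \<pi> :: "'f \<Rightarrow> 'a" and \<kappa> :: "'k rel"
  defines "G \<equiv> F\<lparr>carrier := K\<rparr>" and "S \<equiv> Stone_space (regular_opens (cohen_topology \<kappa>))"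
  assumes A: "comm_group A" and F: "is_free_abelian F" and K: "subgroup K F" and G: "comm_group G"
    and \<pi>: "\<pi> \<in> hom F A" "kernel F A \<pi> = K"
    and B: "is_basis G B" and T: "T \<subseteq> B"
    and s: "\<And>a. a \<in> carrier A \<Longrightarrow> s a \<in> carrier F \<and> \<pi> (s a) = a"
    and rel: "\<And>a b. a \<in> carrier A \<Longrightarrow> b \<in> carrier A \<Longrightarrow>
      Poly_Mapping.keys (coordinates G B (s a \<otimes>\<^bsub>F\<^esub> s b \<otimes>\<^bsub>F\<^esub> inv\<^bsub>F\<^esub> s (a \<otimes>\<^bsub>A\<^esub> b))) \<subseteq> T"
    and e: "inj_on e T" "e ` T \<subseteq> Field \<kappa>"
    and \<psi>: "continuous_map S (Hom_int F) \<psi>"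
    and lift: "\<And>U t. U \<in> topspace S \<Longrightarrow> t \<in> T \<Longrightarrow> \<psi> U t = of_bool (cohen \<kappa> (e t) \<in> U)"
  shows "is_free_abelian A"
proof -
  define b where "b t = cohen \<kappa> (e t)" for t
  have b_inj: "inj_on b T"
    using comp_inj_on [OF e(1) inj_on_subset [OF inj_on_cohen e(2)]] by (simp add: b_def [abs_def] o_def)
  have bT: "b ` T \<subseteq> cohen \<kappa> ` Field \<kappa>" using e(2) by (auto simp: b_def)
  have indep: "\<exists>U\<in>topspace S. U \<inter> G = H" if "finite G" "G \<subseteq> b ` T" "H \<subseteq> G" for G H
    unfolding S_def by (rule cohen_independent [OF that(1) order_trans [OF that(2) bT] that(3)])
  obtain R :: "(('k \<rightharpoonup> bool) set set \<Rightarrow> int) \<Rightarrow> ('k \<rightharpoonup> bool) set \<Rightarrow> int"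
    where R_fin: "\<And>f. depends_on f UNIV \<Longrightarrow> finite {i. R f i \<noteq> 0}"
    and R_add: "\<And>f g h i. depends_on f UNIV \<Longrightarrow> depends_on g UNIV \<Longrightarrow> depends_on h UNIV \<Longrightarrow>
       (\<And>U. U \<in> topspace S \<Longrightarrow> f U = g U + h U) \<Longrightarrow> R f i = R g i + R h i"
    and R_dual: "\<And>f i j. i \<in> b ` T \<Longrightarrow> depends_on f UNIV \<Longrightarrow>
       (\<And>U. U \<in> topspace S \<Longrightarrow> f U = of_bool (i \<in> U)) \<Longrightarrow> R f j = of_bool (i = j)"
  proof -
    show thesis by (rule dual_functionals [of "b ` T" "topspace S"]) (fact indep, fact that)
  qed
  have \<psi>_hom: "\<psi> U \<in> hom F integer_group" if "U \<in> topspace S" for U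
    using \<psi> that unfolding continuous_map_Hom_int by blast
  have "\<exists>f. depends_on f UNIV \<and> (\<forall>U\<in>topspace S. f U = \<psi> U x)" if "x \<in> carrier F" for x
  proof -
    have "continuous_map S (discrete_topology UNIV) (\<lambda>U. \<psi> U x)"
      using \<psi> that unfolding continuous_map_Hom_int by blast
    then show ?thesis
      unfolding S_def topspace_Stone_space by (metis continuous_map_Stone_space_depends_on mem_Collect_eq)
  qed
  \<comment> \<open>\<open>f x\<close> agrees with \<psi> at ultrafilters only, and elsewhere it
    need not be additive in x; hence \<open>R_add\<close> asks for equality on
    \<open>topspace S\<close> alone.\<close>
  then obtain f where f: "\<And>x. x \<in> carrier F \<Longrightarrow> depends_on (f x) UNIV"
    and f_eq: "\<And>x U. x \<in> carrier F \<Longrightarrow> U \<in> topspace S \<Longrightarrow> f x U = \<psi> U x"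
    by metis
  interpret F: comm_group F using F by (simp add: is_free_abelian_def)
  have TF: "t \<in> carrier F" if "t \<in> T" for t
    using that T B subgroup.subset [OF K] by (auto simp: is_basis_def G_def)
  show ?thesis
  proof (rule is_free_abelian_of_dual_functionals [OF A F K G [unfolded G_def] \<pi> B [unfolded G_def] T s rel [unfolded G_def],
        where \<rho> = "\<lambda>x t. R (f x) (b t)"])
    fix x assume "x \<in> carrier F"
    then have "finite (b -` {i. R (f x) i \<noteq> 0} \<inter> T)"
      using finite_vimage_IntI [OF R_fin b_inj] f by blast
    then show "finite {t \<in> T. R (f x) (b t) \<noteq> 0}"
      by (rule rev_finite_subset) auto
  next
    fix x y t assume xy: "x \<in> carrier F" "y \<in> carrier F"
    then have "f (x \<otimes>\<^bsub>F\<^esub> y) U = f x U + f y U" if "U \<in> topspace S" for U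
      using hom_mult [OF \<psi>_hom [OF that] xy] that by (simp add: f_eq)
    then show "R (f (x \<otimes>\<^bsub>F\<^esub> y)) (b t) = R (f x) (b t) + R (f y) (b t)"
      using xy by (intro R_add f F.m_closed)
  next
    fix t u assume tu: "t \<in> T" "u \<in> T"
    have "R (f t) (b u) = of_bool (b t = b u)"
      using tu f_eq [OF TF] lift by (intro R_dual f TF) (auto simp: b_def)
    then show "R (f t) (b u) = of_bool (t = u)"
      using inj_on_eq_iff [OF b_inj tu] by simp
  qed
qed

theorem theorem7p2:
  fixes A :: "('a, 'm) monoid_scheme" and F :: "('f, 'n) monoid_scheme"
    and K :: "'f set" and \<pi> :: "'f \<Rightarrow> 'a" and \<kappa> :: "'k rel"
  defines "S \<equiv> Stone_space (boolean_completion (Add_omega \<kappa>))"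
    and "G\<^sub>K \<equiv> F\<lparr>carrier := K\<rparr>"
  assumes "comm_group A" and "\<not> is_free_abelian A"
    and "Card_order \<kappa>" and "\<kappa> =o |carrier A|"
    and "is_free_abelian F" and "subgroup K F" and "is_free_abelian G\<^sub>K"
    and "\<pi> \<in> epi F A" and "kernel F A \<pi> = K"
  shows "(\<exists>\<phi>. continuous_map S (Hom_int G\<^sub>K) \<phi> \<and>
            \<not> (\<exists>\<psi>. continuous_map S (Hom_int F) \<psi> \<and>
                   (\<forall>U \<in> topspace S. restrict (\<psi> U) K = \<phi> U))) \<and>
         (\<forall>B. is_basis G\<^sub>K B \<longrightarrow>
           (\<exists>\<phi>. continuous_map S (Hom_int G\<^sub>K) \<phi> \<and>
             \<not> (\<exists>\<psi>. continuous_map S (Hom_int F) \<psi> \<and>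
                    (\<forall>U \<in> topspace S. restrict (\<psi> U) K = \<phi> U)) \<and>
             (\<forall>U \<in> topspace S. \<forall>t \<in> B. \<phi> U t \<in> {0, 1})))"
proof -
  note A = \<open>comm_group A\<close> and K = \<open>subgroup K F\<close> and kerK = \<open>kernel F A \<pi> = K\<close>
  have \<pi>: "\<pi> \<in> hom F A" and surj: "\<pi> ` carrier F = carrier A" using \<open>\<pi> \<in> epi F A\<close> by (auto simp: epi_def)
  have G: "comm_group G\<^sub>K" and basis_ex: "\<exists>B. is_basis G\<^sub>K B"
    using \<open>is_free_abelian G\<^sub>K\<close> by (auto simp: is_free_abelian_def)
  have S: "S = Stone_space (regular_opens (cohen_topology \<kappa>))" by (simp add: S_def boolean_completion_eq)
  interpret A: comm_group A by fact
  interpret F: comm_group F using \<open>is_free_abelian F\<close> by (simp add: is_free_abelian_def)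
  interpret \<pi>: group_hom F A \<pi> by (intro group_hom.intro group_hom_axioms.intro \<pi>) auto
  have carrierG: "carrier G\<^sub>K = K" by (simp add: G\<^sub>K_def)
  define s where "s = inv_into (carrier F) \<pi>"
  have s: "s a \<in> carrier F \<and> \<pi> (s a) = a" if "a \<in> carrier A" for a
    unfolding s_def using that surj by (auto intro: inv_into_into f_inv_into_f)
  have main: "\<exists>\<phi>. continuous_map S (Hom_int G\<^sub>K) \<phi> \<and>
             \<not> (\<exists>\<psi>. continuous_map S (Hom_int F) \<psi> \<and>
                    (\<forall>U \<in> topspace S. restrict (\<psi> U) K = \<phi> U)) \<and>
             (\<forall>U \<in> topspace S. \<forall>t \<in> B. \<phi> U t \<in> {0, 1})" if B: "is_basis G\<^sub>K B" for B
  proof -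
    have BK: "B \<subseteq> K" using B by (simp add: is_basis_def carrierG)
    \<comment> \<open>The factor set (2-cocycle) of the extension for the set-theoretic section s;
      it measures how far s is from a homomorphism.\<close>
    define r where "r ab = s (fst ab) \<otimes>\<^bsub>F\<^esub> s (snd ab) \<otimes>\<^bsub>F\<^esub> inv\<^bsub>F\<^esub> s (fst ab \<otimes>\<^bsub>A\<^esub> snd ab)" for ab
    have rK: "r ab \<in> K" if "ab \<in> carrier A \<times> carrier A" for ab
    proof -
      have "\<pi> (r ab) = \<one>\<^bsub>A\<^esub>" "r ab \<in> carrier F" using that s by (auto simp: r_def)
      then show ?thesis using kerK by (auto simp: kernel_def)
    qed
    define T where "T = (\<Union>ab\<in>carrier A \<times> carrier A. Poly_Mapping.keys (coordinates G\<^sub>K B (r ab)))"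
    have TB: "T \<subseteq> B" unfolding T_def using coordinates_props [OF B] rK carrierG by blast
    have rel: "Poly_Mapping.keys (coordinates G\<^sub>K B (s a \<otimes>\<^bsub>F\<^esub> s b \<otimes>\<^bsub>F\<^esub> inv\<^bsub>F\<^esub> s (a \<otimes>\<^bsub>A\<^esub> b))) \<subseteq> T"
      if "a \<in> carrier A" "b \<in> carrier A" for a b
      using that unfolding T_def r_def by fastforce
    \<comment> \<open>If A is finite, so is \<open>Field \<kappa>\<close>, and T may outnumber it;
      an injection of T into the Cohen coordinates is available only for infinite A.\<close>
    show ?thesis
    proof (cases "finite (carrier A)")
      case True
      then have "finite T" unfolding T_def by auto
      \<comment> \<open>If for every t in T some homomorphism on F were 1 at t and 0 on the rest of
        T, these would serve as \<rho>, finiteness of T supplying the finite support, and A would be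
        free.\<close>
      have "\<exists>t\<in>T. \<not> (\<exists>g\<in>hom F integer_group. \<forall>u\<in>T. g u = of_bool (u = t))"
      proof (rule ccontr)
        assume "\<not> ?thesis"
        then obtain g where g: "\<And>t. t \<in> T \<Longrightarrow> g t \<in> hom F integer_group"
          "\<And>t u. t \<in> T \<Longrightarrow> u \<in> T \<Longrightarrow> g t u = of_bool (u = t)" by metis
        have "is_free_abelian A"
        proof (rule is_free_abelian_of_dual_functionals [OF A \<open>is_free_abelian F\<close> K G [unfolded G\<^sub>K_def]
              \<pi> kerK B [unfolded G\<^sub>K_def] TB s rel [unfolded G\<^sub>K_def], where \<rho> = "\<lambda>x t. g t x"])
          fix x y t assume "x \<in> carrier F" "y \<in> carrier F" "t \<in> T"
          then show "g t (x \<otimes>\<^bsub>F\<^esub> y) = g t x + g t y" using hom_mult [OF g(1)] by fastforce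
        qed (use \<open>finite T\<close> g(2) in auto)
        with \<open>\<not> is_free_abelian A\<close> show False by blast
      qed
      then obtain t where t: "t \<in> T" "\<And>g. g \<in> hom F integer_group \<Longrightarrow> \<not> (\<forall>u\<in>T. g u = of_bool (u = t))"
        by blast
      let ?\<phi> = "\<lambda>U :: ('k \<rightharpoonup> bool) set set. linear_extension G\<^sub>K B (\<lambda>u. of_bool (u = t))"
      have val: "?\<phi> U u = of_bool (u = t)" if "u \<in> B" for U u
        by (rule linear_extension_basis [OF G B that])
      \<comment> \<open>Refuting a lift of a constant map takes a point to evaluate at; the empty
        pattern provides one.\<close>
      obtain U where U: "U \<in> topspace S"
        using cohen_independent [of "{}" \<kappa> "{}"] by (auto simp: S)
      have "False" if \<psi>: "continuous_map S (Hom_int F) \<psi>" "\<forall>U\<in>topspace S. restrict (\<psi> U) K = ?\<phi> U" for \<psi>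
      proof -
        have "\<psi> U \<in> hom F integer_group" using \<psi>(1) U unfolding continuous_map_Hom_int by blast
        moreover have "\<psi> U u = of_bool (u = t)" if "u \<in> T" for u
        proof -
          have u: "u \<in> B" "u \<in> K" using that TB BK by auto
          then have "\<psi> U u = ?\<phi> U u" using \<psi>(2) U by (metis restrict_apply')
          then show ?thesis using val [OF u(1)] by simp
        qed
        ultimately show False using t(2) by blast
      qed
      moreover have "continuous_map S (Hom_int G\<^sub>K) ?\<phi>"
        by (rule continuous_map_linear_extension [OF G B]) simp
      moreover have "\<forall>U\<in>topspace S. \<forall>t\<in>B. ?\<phi> U t \<in> {0, 1}" using val by simp
      ultimately show ?thesis by blast
    next
      case False
      \<comment> \<open>There are as many relations as elements of A, and each has finitely many
        coordinates.\<close>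
      have "|carrier A \<times> carrier A| \<le>o |carrier A|"
        using card_of_Times_same_infinite [OF False] ordIso_imp_ordLeq by blast
      moreover have "|Poly_Mapping.keys (coordinates G\<^sub>K B (r ab))| \<le>o |carrier A|" for ab
        using finite_keys False by (intro ordLess_imp_ordLeq finite_ordLess_infinite2) auto
      ultimately have "|T| \<le>o |carrier A|"
        unfolding T_def by (intro card_of_UNION_ordLeq_infinite [OF False]) auto
      moreover have "|carrier A| =o |Field \<kappa>|"
        using card_of_Field_ordIso [OF \<open>Card_order \<kappa>\<close>] \<open>\<kappa> =o |carrier A|\<close>
        by (meson ordIso_symmetric ordIso_transitive)
      ultimately have "|T| \<le>o |Field \<kappa>|" by (rule ordLeq_ordIso_trans)
      then obtain e where e: "inj_on e T" "e ` T \<subseteq> Field \<kappa>" unfolding card_of_ordLeq [symmetric] by blast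
      \<comment> \<open>Basis elements outside T occur in no relation; the default 0 keeps the map
        continuous with values in {0, 1}.\<close>
      define v where "v U t = (if t \<in> T then of_bool (cohen \<kappa> (e t) \<in> U) else (0::int))" for U t
      let ?\<phi> = "\<lambda>U. linear_extension G\<^sub>K B (v U)"
      have "continuous_map S (Hom_int G\<^sub>K) ?\<phi>"
      proof (rule continuous_map_linear_extension [OF G B])
        fix t assume "t \<in> B"
        show "continuous_map S (discrete_topology UNIV) (\<lambda>U. v U t)"
          using continuous_map_Stone_space_of_bool [OF cohen_regular_open, of \<kappa> "e t"]
          by (cases "t \<in> T") (simp_all add: v_def S)
      qed
      moreover have val: "?\<phi> U t = v U t" if "t \<in> B" for U t
        by (rule linear_extension_basis [OF G B that])
      moreover have "False" if \<psi>: "continuous_map S (Hom_int F) \<psi>" "\<forall>U\<in>topspace S. restrict (\<psi> U) K = ?\<phi> U" for \<psi>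
      proof -
        have "\<psi> U t = of_bool (cohen \<kappa> (e t) \<in> U)" if "U \<in> topspace S" "t \<in> T" for U t
        proof -
          have t: "t \<in> B" "t \<in> K" using that(2) TB BK by auto
          then have "\<psi> U t = ?\<phi> U t" using \<psi>(2) that(1) by (metis restrict_apply')
          then show ?thesis using val [OF t(1)] that(2) by (simp add: v_def)
        qed
        then have "is_free_abelian A"
          by (intro is_free_abelian_of_lift [OF A \<open>is_free_abelian F\<close> K G [unfolded G\<^sub>K_def]
              \<pi> kerK B [unfolded G\<^sub>K_def] TB s rel [unfolded G\<^sub>K_def] e \<psi>(1) [unfolded S]]) (auto simp: S)
        with \<open>\<not> is_free_abelian A\<close> show False by blast
      qed
      moreover have "\<forall>U\<in>topspace S. \<forall>t\<in>B. ?\<phi> U t \<in> {0, 1}" using val by (simp add: v_def)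
      ultimately show ?thesis by blast
    qed
  qed
  obtain B where "is_basis G\<^sub>K B" using basis_ex by blast
  from main [OF this] main show ?thesis by (intro conjI allI impI) blast+
qed

end
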